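(* Let $(X,A_1,\dots,A_n)$ satisfy condition $( * )$, let $p:X\to X/(A_1,\dots,A_n)$ be the quotient map, $a\in\bigcup_{i=1}^nA_i$ and $*=p(a)$. If $\pi_1^{top}(X,a)$ is compact and $\pi_1^{top}(X/(A_1,\dots,A_n),* )$ is Hausdorff, then $\pi_1^{top}(X/(A_1,\dots,A_n),* )$ is either a discrete topological group or uncountable.
   Context: $X/(A_1,\dots,A_n)$ denotes the quotient space of $X$ by the equivalence relation generated by identifying all points of $A_i$ with each other for each $i$. $\pi_1^{top}(Y,y)$ is $\pi_1(Y,y)$ with the quotient topology with respect to the canonical surjection from the loop space $\Omega(Y,y)$ (based loops with the compact-open topology). Condition $( * )$ on $(X,A_1,\dots,A_n)$ means one of: (i) $X$ is path connected and the $A_i$ are open subsets of $X$ whose closures are path connected; or (ii) $X$ is connected, locally path connected and first countable, and each $A_i$ is an open or closed subset of $X$, the closures $\overline{A_i}$ being path connected and pairwise disjoint. *)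

theory Defs
  imports "HOL-Analysis.Analysis"
begin

definition quotient_topology :: "'a topology \<Rightarrow> ('a \<Rightarrow> 'b) \<Rightarrow> 'b topology" where
  "quotient_topology X f =
     topology (\<lambda>U. U \<subseteq> f ` topspace X \<and> openin X {x \<in> topspace X. f x \<in> U})"

definition collapse_rel :: "'a topology \<Rightarrow> (nat \<Rightarrow> 'a set) \<Rightarrow> nat \<Rightarrow> ('a \<times> 'a) set" where
  "collapse_rel X A n = (Id_on (topspace X) \<union> {(x, y). \<exists>i<n. x \<in> A i \<and> y \<in> A i})\<^sup>*"

definition collapse_map :: "'a topology \<Rightarrow> (nat \<Rightarrow> 'a set) \<Rightarrow> nat \<Rightarrow> 'a \<Rightarrow> 'a set" where
  "collapse_map X A n x = {y \<in> topspace X. (x, y) \<in> collapse_rel X A n}"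

definition collapse_space :: "'a topology \<Rightarrow> (nat \<Rightarrow> 'a set) \<Rightarrow> nat \<Rightarrow> 'a set topology" where
  "collapse_space X A n = quotient_topology X (collapse_map X A n)"

definition loops :: "'a topology \<Rightarrow> 'a \<Rightarrow> (real \<Rightarrow> 'a) set" where
  "loops X a = {g. pathin X g \<and> g 0 = a \<and> g 1 = a}"

definition loop_space :: "'a topology \<Rightarrow> 'a \<Rightarrow> (real \<Rightarrow> 'a) topology" where
  "loop_space X a = topology_generated_by
     {{g \<in> loops X a. g ` K \<subseteq> U} | K U. compactin (top_of_set {0..1}) K \<and> openin X U}"

definition loop_homotopic :: "'a topology \<Rightarrow> 'a \<Rightarrow> (real \<Rightarrow> 'a) \<Rightarrow> (real \<Rightarrow> 'a) \<Rightarrow> bool" where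
  "loop_homotopic X a f g \<longleftrightarrow>
     homotopic_with (\<lambda>h. h 0 = a \<and> h 1 = a) (top_of_set {0..1}) X f g"

definition loop_class :: "'a topology \<Rightarrow> 'a \<Rightarrow> (real \<Rightarrow> 'a) \<Rightarrow> (real \<Rightarrow> 'a) set" where
  "loop_class X a g = {h \<in> loops X a. loop_homotopic X a g h}"

definition pi1_top :: "'a topology \<Rightarrow> 'a \<Rightarrow> (real \<Rightarrow> 'a) set topology" where
  "pi1_top X a = quotient_topology (loop_space X a) (loop_class X a)"

definition condition_star :: "'a topology \<Rightarrow> (nat \<Rightarrow> 'a set) \<Rightarrow> nat \<Rightarrow> bool" where
  "condition_star X A n \<longleftrightarrow>
     (path_connected_space X \<and>
      (\<forall>i<n. openin X (A i) \<and> path_connectedin X (X closure_of (A i))))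
   \<or> (connected_space X \<and> locally_path_connected_space X \<and> first_countable X \<and>
      (\<forall>i<n. (openin X (A i) \<or> closedin X (A i)) \<and> path_connectedin X (X closure_of (A i))) \<and>
      (\<forall>i<n. \<forall>j<n. i \<noteq> j \<longrightarrow> X closure_of (A i) \<inter> X closure_of (A j) = {}))"

end

theory Submission
  imports Defs
begin

text \<open>
  The loops \<open>p \<circ> \<alpha>\<close> with \<open>\<alpha>\<close> a loop in \<open>X\<close> have dense image in \<open>\<pi>\<^sub>1\<close> of the quotient. Hence, if
  \<open>\<pi>\<^sub>1(X)\<close> is compact and \<open>\<pi>\<^sub>1\<close> of the quotient is Hausdorff, the induced homomorphism is onto and
  \<open>\<pi>\<^sub>1\<close> of the quotient is compact. A countable compact Hausdorff space has an isolated point, and left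
  translations, being continuous, carry this point to every other one.

  For density, collapse one set \<open>A\<close> at a time. A loop in the quotient is lifted piecewise, on the pieces of
  a fine subdivision: away from the image of \<open>A\<close> the lift is unique, and near a time at which the loop
  meets the image of the closure of \<open>A\<close> one may run into that closure, travel inside it, and come back. If \<open>A\<close> is open,
  the lifted path reaches the closure by itself, and a path inside the closure projects to a path that is
  homotopic to one resting at the open point \<open>p(A)\<close>. If \<open>A\<close> is closed, local path connectedness supplies
  the path leading into \<open>A\<close>.
\<close>

section \<open>Quotient topologies and pasting\<close>

lemma openin_quotient_topology:
  "openin (quotient_topology X f) U \<longleftrightarrow> U \<subseteq> f ` topspace X \<and> openin X {x \<in> topspace X. f x \<in> U}"
proof -
  have "istopology (\<lambda>U. U \<subseteq> f ` topspace X \<and> openin X {x \<in> topspace X. f x \<in> U})"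
    unfolding istopology_def
  proof (intro conjI allI impI)
    fix S T
    assume "S \<subseteq> f ` topspace X \<and> openin X {x \<in> topspace X. f x \<in> S}"
      and "T \<subseteq> f ` topspace X \<and> openin X {x \<in> topspace X. f x \<in> T}"
    moreover have "{x \<in> topspace X. f x \<in> S \<inter> T} = {x \<in> topspace X. f x \<in> S} \<inter> {x \<in> topspace X. f x \<in> T}"
      by auto
    ultimately show "S \<inter> T \<subseteq> f ` topspace X" "openin X {x \<in> topspace X. f x \<in> S \<inter> T}"
      by auto
  next
    fix K
    assume K: "\<forall>S\<in>K. S \<subseteq> f ` topspace X \<and> openin X {x \<in> topspace X. f x \<in> S}"
    have "{x \<in> topspace X. f x \<in> \<Union>K} = (\<Union>S\<in>K. {x \<in> topspace X. f x \<in> S})"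
      by auto
    then show "openin X {x \<in> topspace X. f x \<in> \<Union>K}"
      using K by auto
    show "\<Union>K \<subseteq> f ` topspace X" using K by blast
  qed
  then show ?thesis
    by (simp add: quotient_topology_def)
qed

lemma topspace_quotient_topology [simp]: "topspace (quotient_topology X f) = f ` topspace X"
proof
  show "topspace (quotient_topology X f) \<subseteq> f ` topspace X"
    using openin_quotient_topology[of X f "topspace (quotient_topology X f)"] by simp
  have "{x \<in> topspace X. f x \<in> f ` topspace X} = topspace X"
    by auto
  then have "openin (quotient_topology X f) (f ` topspace X)"
    by (simp add: openin_quotient_topology)
  then show "f ` topspace X \<subseteq> topspace (quotient_topology X f)"
    by (rule openin_subset)
qed

lemma quotient_map_quotient_topology: "quotient_map X (quotient_topology X f) f"
  by (simp add: quotient_map_def openin_quotient_topology)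

lemma continuous_map_top_of_set_compose:
  assumes "continuous_map (top_of_set T) Y F" "continuous_on S \<phi>" "\<And>x. x \<in> S \<Longrightarrow> \<phi> x \<in> T"
  shows "continuous_map (top_of_set S) Y (\<lambda>x. F (\<phi> x))"
proof -
  have "continuous_map (top_of_set S) (top_of_set T) \<phi>"
    using assms by (auto simp: continuous_map_in_subtopology)
  then show ?thesis
    using continuous_map_compose[OF _ assms(1)] unfolding o_def by blast
qed

lemma continuous_map_top_of_set_paste:
  fixes q :: "'a::topological_space \<Rightarrow> real"
  assumes "continuous_on S q"
    and "continuous_map (top_of_set {x \<in> S. q x \<le> c}) Y f"
    and "continuous_map (top_of_set {x \<in> S. c \<le> q x}) Y g"
    and "\<And>x. x \<in> S \<Longrightarrow> q x = c \<Longrightarrow> f x = g x"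
  shows "continuous_map (top_of_set S) Y (\<lambda>x. if q x \<le> c then f x else g x)"
proof (rule continuous_map_cases_le)
  have "S \<inter> {x. x \<in> topspace (top_of_set S) \<and> P x} = {x \<in> S. P x}" for P
    by auto
  then show "continuous_map (subtopology (top_of_set S) {x \<in> topspace (top_of_set S). q x \<le> c}) Y f"
    "continuous_map (subtopology (top_of_set S) {x \<in> topspace (top_of_set S). c \<le> q x}) Y g"
    using assms by (simp_all only: subtopology_subtopology)
qed (use assms in auto)

section \<open>The topological fundamental group\<close>

lemma loop_homotopicI:
  fixes H :: "real \<times> real \<Rightarrow> 'a"
  assumes "continuous_map (top_of_set ({0..1} \<times> {0..1})) X H"
    and "\<And>u. u \<in> {0..1} \<Longrightarrow> H (0, u) = f u" "\<And>u. u \<in> {0..1} \<Longrightarrow> H (1, u) = g u"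
    and "\<And>t. t \<in> {0..1} \<Longrightarrow> H (t, 0) = a" "\<And>t. t \<in> {0..1} \<Longrightarrow> H (t, 1) = a"
  shows "loop_homotopic X a f g"
proof -
  have "homotopic_with (\<lambda>h. h 0 = a \<and> h 1 = a) (top_of_set {0..1}) X f g"
  proof (subst homotopic_with)
    show "\<exists>h :: real \<times> real \<Rightarrow> 'a. continuous_map (prod_topology (top_of_set {0..1}) (top_of_set {0..1})) X h \<and>
        (\<forall>x\<in>topspace (top_of_set {0..1}). h (0, x) = f x) \<and>
        (\<forall>x\<in>topspace (top_of_set {0..1}). h (1, x) = g x) \<and>
        (\<forall>t\<in>{0..1}. h (t, 0) = a \<and> h (t, 1) = a)"
      by (intro exI[of _ H]) (use assms in simp)
  qed simp
  then show ?thesis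
    by (simp add: loop_homotopic_def)
qed

lemma loop_homotopicE:
  assumes "loop_homotopic X a f g"
  obtains H :: "real \<times> real \<Rightarrow> 'a" where "continuous_map (top_of_set ({0..1} \<times> {0..1})) X H"
    and "\<And>u. H (0, u) = f u" "\<And>u. H (1, u) = g u"
    and "\<And>t. t \<in> {0..1} \<Longrightarrow> H (t, 0) = a" "\<And>t. t \<in> {0..1} \<Longrightarrow> H (t, 1) = a"
  using assms unfolding loop_homotopic_def homotopic_with_def prod_topology_subtopology_eu by blast

lemma loop_homotopic_refl: "g \<in> loops X a \<Longrightarrow> loop_homotopic X a g g"
  by (simp add: loop_homotopic_def loops_def pathin_def)

lemma loop_homotopic_sym: "loop_homotopic X a f g \<Longrightarrow> loop_homotopic X a g f"
  unfolding loop_homotopic_def by (rule homotopic_with_symD)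

lemma loop_homotopic_trans:
  "loop_homotopic X a f g \<Longrightarrow> loop_homotopic X a g h \<Longrightarrow> loop_homotopic X a f h"
  unfolding loop_homotopic_def by (rule homotopic_with_trans)

lemma loop_class_eq_iff:
  assumes "f \<in> loops X a" "g \<in> loops X a"
  shows "loop_class X a f = loop_class X a g \<longleftrightarrow> loop_homotopic X a f g"
  using assms unfolding loop_class_def
  by (auto dest: loop_homotopic_sym loop_homotopic_trans loop_homotopic_refl)

lemma loop_homotopic_compose:
  assumes "continuous_map X Y p" "loop_homotopic X a f g"
  shows "loop_homotopic Y (p a) (p \<circ> f) (p \<circ> g)"
  using assms unfolding loop_homotopic_def
  by (auto intro: homotopic_with_compose_continuous_map_left)

lemma compose_in_loops:
  assumes "continuous_map X Y p" "f \<in> loops X a"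
  shows "p \<circ> f \<in> loops Y (p a)"
  using assms by (auto simp: loops_def intro: pathin_compose)

lemma topspace_loop_space [simp]: "topspace (loop_space X a) = loops X a"
proof -
  have "{g \<in> loops X a. g ` {} \<subseteq> {}} \<in> {{g \<in> loops X a. g ` K \<subseteq> U} | K U. compactin (top_of_set {0..1}) K \<and> openin X U}"
    by blast
  then show ?thesis
    by (auto simp: loop_space_def)
qed

lemma openin_loop_space_subbasic:
  "compact K \<Longrightarrow> K \<subseteq> {0..1} \<Longrightarrow> openin X U \<Longrightarrow> openin (loop_space X a) {g \<in> loops X a. g ` K \<subseteq> U}"
  unfolding loop_space_def
  by (intro topology_generated_by_Basis CollectI exI[of _ K] exI[of _ U]) (auto simp: compactin_subtopology)

lemma continuous_map_into_loop_space:
  assumes "\<And>z. z \<in> topspace Z \<Longrightarrow> F z \<in> loops X a"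
    and "\<And>K U. compact K \<Longrightarrow> K \<subseteq> {0..1} \<Longrightarrow> openin X U \<Longrightarrow> openin Z {z \<in> topspace Z. F z ` K \<subseteq> U}"
  shows "continuous_map Z (loop_space X a) F"
proof -
  have "openin Z (F -` W \<inter> topspace Z)"
    if W: "W \<in> {{g \<in> loops X a. g ` K \<subseteq> U} | K U. compactin (top_of_set {0..1}) K \<and> openin X U}" for W
  proof -
    obtain K U where "W = {g \<in> loops X a. g ` K \<subseteq> U}" and KU: "compact K" "K \<subseteq> {0..1}" "openin X U"
      using W unfolding compactin_subtopology compactin_euclidean_iff by blast
    then have "F -` W \<inter> topspace Z = {z \<in> topspace Z. F z ` K \<subseteq> U}"
      using assms(1) by auto
    then show ?thesis using assms(2)[OF KU] by simp
  qed
  moreover have "F ` topspace Z \<subseteq> topspace (loop_space X a)"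
    using assms(1) by auto
  ultimately show ?thesis
    unfolding loop_space_def by (intro continuous_on_generated_topo) (auto simp only: topology_generated_by_topspace)
qed

lemma continuous_map_loop_space_compose:
  assumes p: "continuous_map X Y p"
  shows "continuous_map (loop_space X a) (loop_space Y (p a)) ((\<circ>) p)"
proof (rule continuous_map_into_loop_space)
  fix K :: "real set" and U assume KU: "compact K" "K \<subseteq> {0..1}" "openin Y U"
  have "g \<in> loops X a \<Longrightarrow> (p \<circ> g) ` K \<subseteq> U \<longleftrightarrow> g ` K \<subseteq> {x \<in> topspace X. p x \<in> U}" for g
    using KU(2) by (auto simp: loops_def pathin_def continuous_map_def Pi_iff)
  then have "{g \<in> topspace (loop_space X a). (p \<circ> g) ` K \<subseteq> U} =
      {g \<in> loops X a. g ` K \<subseteq> {x \<in> topspace X. p x \<in> U}}"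
    by auto
  then show "openin (loop_space X a) {g \<in> topspace (loop_space X a). (p \<circ> g) ` K \<subseteq> U}"
    using openin_loop_space_subbasic[OF KU(1,2) openin_continuous_map_preimage[OF p KU(3)]] by simp
qed (use assms compose_in_loops in auto)

lemma topspace_pi1_top: "topspace (pi1_top X a) = loop_class X a ` loops X a"
  by (simp add: pi1_top_def)

lemma quotient_map_loop_class: "quotient_map (loop_space X a) (pi1_top X a) (loop_class X a)"
  unfolding pi1_top_def by (rule quotient_map_quotient_topology)

lemma continuous_map_pi1_induced:
  assumes F: "continuous_map (loop_space X a) (loop_space Y b) F"
    and hom: "\<And>f g. f \<in> loops X a \<Longrightarrow> g \<in> loops X a \<Longrightarrow> loop_homotopic X a f g \<Longrightarrow> loop_homotopic Y b (F f) (F g)"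
  obtains G where "continuous_map (pi1_top X a) (pi1_top Y b) G"
    "\<And>f. f \<in> loops X a \<Longrightarrow> G (loop_class X a f) = loop_class Y b (F f)"
proof -
  have cont: "continuous_map (loop_space X a) (pi1_top Y b) (loop_class Y b \<circ> F)"
    by (rule continuous_map_compose[OF F]) (simp add: quotient_imp_continuous_map quotient_map_loop_class)
  have loops: "f \<in> loops X a \<Longrightarrow> F f \<in> loops Y b" for f
    using F by (auto simp: continuous_map_def)
  have eq: "\<And>f g. f \<in> topspace (loop_space X a) \<Longrightarrow> g \<in> topspace (loop_space X a) \<Longrightarrow>
      loop_class X a f = loop_class X a g \<Longrightarrow> (loop_class Y b \<circ> F) f = (loop_class Y b \<circ> F) g"
    using loops hom by (simp add: loop_class_eq_iff)
  obtain G where "continuous_map (pi1_top X a) (pi1_top Y b) G"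
     "\<forall>f\<in>topspace (loop_space X a). G (loop_class X a f) = (loop_class Y b \<circ> F) f"
    by (rule quotient_map_lift_exists[OF quotient_map_loop_class cont eq]) blast+
  then show ?thesis using that by auto
qed

definition loop_join :: "(real \<Rightarrow> 'a) \<Rightarrow> (real \<Rightarrow> 'a) \<Rightarrow> real \<Rightarrow> 'a" where
  "loop_join k h t = (if t \<le> 1/2 then k (2 * t) else h (2 * t - 1))"

definition loop_rev :: "(real \<Rightarrow> 'a) \<Rightarrow> real \<Rightarrow> 'a" where
  "loop_rev k t = k (1 - t)"

lemma loops_continuous: "k \<in> loops X a \<Longrightarrow> continuous_map (top_of_set {0..1}) X k"
  by (simp add: loops_def pathin_def)

lemma loop_rev_in_loops:
  assumes "k \<in> loops X a"
  shows "loop_rev k \<in> loops X a"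
proof -
  have "continuous_map (top_of_set {0..1}) X (\<lambda>t. k (1 - t))"
    by (rule continuous_map_top_of_set_compose[OF loops_continuous[OF assms]]) (auto intro!: continuous_intros)
  then show ?thesis
    using assms unfolding loops_def pathin_def loop_rev_def by simp
qed

lemma loop_join_in_loops:
  assumes "k \<in> loops X a" "h \<in> loops X a"
  shows "loop_join k h \<in> loops X a"
proof -
  have "continuous_map (top_of_set {0..1}) X (\<lambda>t. if t \<le> 1/2 then k (2 * t) else h (2 * t - 1))"
  proof (rule continuous_map_top_of_set_paste)
    show "continuous_map (top_of_set {t \<in> {0..1}. t \<le> 1/2}) X (\<lambda>t. k (2 * t))"
      by (rule continuous_map_top_of_set_compose[OF loops_continuous[OF assms(1)]]) (auto intro!: continuous_intros)
    show "continuous_map (top_of_set {t \<in> {0..1}. 1/2 \<le> t}) X (\<lambda>t. h (2 * t - 1))"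
      by (rule continuous_map_top_of_set_compose[OF loops_continuous[OF assms(2)]]) (auto intro!: continuous_intros)
    show "k (2 * t) = h (2 * t - 1)" if "t = 1/2" for t
      unfolding that using assms by (simp add: loops_def)
  qed simp
  then show ?thesis
    using assms unfolding loops_def pathin_def loop_join_def by simp
qed

lemma loop_homotopic_reparam:
  fixes F :: "real \<Rightarrow> 'a"
  assumes F: "continuous_map (top_of_set {c..d}) X F"
    and "continuous_on {0..1} \<phi>" "continuous_on {0..1} \<psi>"
    and "\<And>t. t \<in> {0..1} \<Longrightarrow> \<phi> t \<in> {c..d}" "\<And>t. t \<in> {0..1} \<Longrightarrow> \<psi> t \<in> {c..d}"
    and "\<phi> 0 = \<psi> 0" "\<phi> 1 = \<psi> 1" "F (\<phi> 0) = a" "F (\<phi> 1) = a"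
    and "\<And>t. t \<in> {0..1} \<Longrightarrow> f t = F (\<phi> t)" "\<And>t. t \<in> {0..1} \<Longrightarrow> g t = F (\<psi> t)"
  shows "loop_homotopic X a f g"
proof (rule loop_homotopicI)
  show "continuous_map (top_of_set ({0..1} \<times> {0..1})) X
      (\<lambda>z. F ((1 - fst z) * \<phi> (snd z) + fst z * \<psi> (snd z)))"
  proof (rule continuous_map_top_of_set_compose[OF F])
    show "continuous_on ({0..1} \<times> {0..1}) (\<lambda>z. (1 - fst z) * \<phi> (snd z) + fst z * \<psi> (snd z))"
      by (intro continuous_intros continuous_on_compose2[OF assms(2)] continuous_on_compose2[OF assms(3)]) auto
    fix z :: "real \<times> real" assume z: "z \<in> {0..1} \<times> {0..1}"
    have "(1 - fst z) *\<^sub>R \<phi> (snd z) + fst z *\<^sub>R \<psi> (snd z) \<in> {c..d}"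
      by (rule convexD_alt) (use assms z in auto)
    then show "(1 - fst z) * \<phi> (snd z) + fst z * \<psi> (snd z) \<in> {c..d}"
      by simp
  qed
  show "F ((1 - fst (t, 0)) * \<phi> (snd (t, 0)) + fst (t, 0) * \<psi> (snd (t, 0))) = a" for t
    using assms(6,8) by (simp add: algebra_simps)
  show "F ((1 - fst (t, 1)) * \<phi> (snd (t, 1)) + fst (t, 1) * \<psi> (snd (t, 1))) = a" for t
    using assms(7,9) by (simp add: algebra_simps)
  show "F ((1 - fst (0, u)) * \<phi> (snd (0, u)) + fst (0, u) * \<psi> (snd (0, u))) = f u" if "u \<in> {0..1}" for u
    unfolding assms(10)[OF that] by simp
  show "F ((1 - fst (1, u)) * \<phi> (snd (1, u)) + fst (1, u) * \<psi> (snd (1, u))) = g u" if "u \<in> {0..1}" for u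
    unfolding assms(11)[OF that] by simp
qed

lemma continuous_map_concat:
  assumes "k \<in> loops X a" "h \<in> loops X a"
  shows "continuous_map (top_of_set {0..2}) X (\<lambda>t. if t \<le> 1 then k t else h (t - 1))"
proof (rule continuous_map_top_of_set_paste)
  show "continuous_map (top_of_set {t \<in> {0..2}. t \<le> 1}) X k"
    by (rule continuous_map_top_of_set_compose[OF loops_continuous[OF assms(1)]]) (auto intro!: continuous_intros)
  show "continuous_map (top_of_set {t \<in> {0..2}. 1 \<le> t}) X (\<lambda>t. h (t - 1))"
    by (rule continuous_map_top_of_set_compose[OF loops_continuous[OF assms(2)]]) (auto intro!: continuous_intros)
qed (use assms in \<open>auto simp: loops_def\<close>)

lemma loop_join_rev_cancel:
  assumes "k \<in> loops X a" "h \<in> loops X a"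
  shows "loop_homotopic X a (loop_join (loop_rev k) (loop_join k h)) h"
proof (rule loop_homotopic_reparam[OF continuous_map_concat[OF assms]])
  let ?F = "\<lambda>t. if t \<le> 1 then k t else h (t - 1)"
  have F: "?F t = h (t - 1)" if "t \<ge> 1" for t
    using that assms by (cases "t = 1") (auto simp: loops_def)
  show "continuous_on {0..1} (\<lambda>t::real. max (1 - 2 * t) (4 * t - 2))" "continuous_on {0..1} (\<lambda>t::real. 1 + t)"
    by (intro continuous_intros)+
  show "loop_join (loop_rev k) (loop_join k h) t = ?F (max (1 - 2 * t) (4 * t - 2))" if "t \<in> {0..1}" for t
  proof (cases "t \<le> 1/2")
    case True
    with that have "max (1 - 2 * t) (4 * t - 2) = 1 - 2 * t" by simp
    then show ?thesis using True that by (simp add: loop_join_def loop_rev_def)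
  next
    case False
    with that have "max (1 - 2 * t) (4 * t - 2) = 4 * t - 2" by simp
    moreover have "2 * (2 * t - 1) = 4 * t - 2" "2 * (2 * t - 1) - 1 = 4 * t - 2 - 1" by simp_all
    moreover have "2 * t - 1 \<le> 1/2 \<longleftrightarrow> 4 * t - 2 \<le> 1" by linarith
    ultimately show ?thesis using False that unfolding loop_join_def by (simp only: if_False)
  qed
  show "h t = ?F (1 + t)" if "t \<in> {0..1}" for t
    using that by (subst F) simp_all
qed (use assms in \<open>auto simp: loops_def\<close>)

lemma loop_join_rev_cancel_right:
  assumes "c \<in> loops X a" "g \<in> loops X a"
  shows "loop_homotopic X a (loop_join (loop_join c (loop_rev g)) g) c"
proof (rule loop_homotopic_reparam[OF continuous_map_concat[OF assms(1) loop_rev_in_loops[OF assms(2)]]])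
  let ?F = "\<lambda>t. if t \<le> 1 then c t else loop_rev g (t - 1)"
  have F: "?F t = g (2 - t)" if "t \<ge> 1" for t
    using that assms by (cases "t = 1") (auto simp: loops_def loop_rev_def)
  show "continuous_on {0..1} (\<lambda>t::real. min (4 * t) (3 - 2 * t))" "continuous_on {0..1} (\<lambda>t::real. t)"
    by (intro continuous_intros)+
  show "loop_join (loop_join c (loop_rev g)) g t = ?F (min (4 * t) (3 - 2 * t))" if "t \<in> {0..1}" for t
  proof (cases "t \<le> 1/2")
    case True
    with that have "min (4 * t) (3 - 2 * t) = 4 * t" by simp
    moreover have "2 * (2 * t) = 4 * t" "2 * t \<le> 1/2 \<longleftrightarrow> 4 * t \<le> 1" by auto
    ultimately show ?thesis using True that unfolding loop_join_def by (simp only: if_True)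
  next
    case False
    with that have "min (4 * t) (3 - 2 * t) = 3 - 2 * t" by simp
    moreover have "2 - (3 - 2 * t) = 2 * t - 1" by simp
    moreover have "?F (3 - 2 * t) = g (2 - (3 - 2 * t))"
      by (rule F) (use that in simp)
    moreover have "loop_join (loop_join c (loop_rev g)) g t = g (2 * t - 1)"
      using False by (simp add: loop_join_def)
    ultimately show ?thesis by (simp only:)
  qed
qed (use assms in \<open>auto simp: loops_def\<close>)

lemma loop_join_cong:
  assumes "k \<in> loops X a" "loop_homotopic X a h h'"
  shows "loop_homotopic X a (loop_join k h) (loop_join k h')"
proof -
  obtain H :: "real \<times> real \<Rightarrow> 'a" where H: "continuous_map (top_of_set ({0..1} \<times> {0..1})) X H"
    "\<And>u. H (0, u) = h u" "\<And>u. H (1, u) = h' u"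
    "\<And>t. t \<in> {0..1} \<Longrightarrow> H (t, 0) = a" "\<And>t. t \<in> {0..1} \<Longrightarrow> H (t, 1) = a"
    using loop_homotopicE[OF assms(2)] by metis
  show ?thesis
  proof (rule loop_homotopicI)
    show "continuous_map (top_of_set ({0..1} \<times> {0..1})) X
       (\<lambda>z. if snd z \<le> 1/2 then k (2 * snd z) else H (fst z, 2 * snd z - 1))"
    proof (rule continuous_map_top_of_set_paste)
      show "continuous_map (top_of_set {z \<in> {0..1} \<times> {0..1}. snd z \<le> 1/2}) X (\<lambda>z. k (2 * snd z))"
        by (rule continuous_map_top_of_set_compose[OF loops_continuous[OF assms(1)]]) (auto intro!: continuous_intros)
      show "continuous_map (top_of_set {z \<in> {0..1} \<times> {0..1}. 1/2 \<le> snd z}) X (\<lambda>z. H (fst z, 2 * snd z - 1))"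
        by (rule continuous_map_top_of_set_compose[OF H(1)]) (auto intro!: continuous_intros)
      show "k (2 * snd z) = H (fst z, 2 * snd z - 1)" if "z \<in> {0..1} \<times> {0..1}" "snd z = 1/2" for z
        unfolding that(2) using that(1) assms H by (auto simp: loops_def)
    qed (intro continuous_intros)
  qed (use assms(1) H in \<open>auto simp: loop_join_def loops_def\<close>)
qed

lemma continuous_map_loop_join:
  assumes k: "k \<in> loops X a"
  shows "continuous_map (loop_space X a) (loop_space X a) (loop_join k)"
proof (rule continuous_map_into_loop_space)
  fix K :: "real set" and U assume KU: "compact K" "K \<subseteq> {0..1}" "openin X U"
  define K1 where "K1 = K \<inter> {0..1/2}"
  define K2 where "K2 = (\<lambda>t. 2 * t - 1) ` (K \<inter> {1/2..1})"
  have "compact K2"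
    unfolding K2_def using KU by (intro compact_continuous_image continuous_intros compact_Int_closed) auto
  moreover have "K2 \<subseteq> {0..1}"
    by (auto simp: K2_def)
  ultimately have op: "openin (loop_space X a) {h \<in> loops X a. h ` K2 \<subseteq> U}"
    using KU by (intro openin_loop_space_subbasic)
  have "loop_join k h ` K \<subseteq> U \<longleftrightarrow> (\<forall>t\<in>K1. k (2 * t) \<in> U) \<and> h ` K2 \<subseteq> U" if h: "h \<in> loops X a" for h
  proof -
    have eq: "loop_join k h t = h (2 * t - 1)" if "t \<ge> 1/2" for t
    proof (cases "t = 1/2")
      case True
      show ?thesis unfolding True using h k by (simp add: loop_join_def loops_def)
    qed (use that in \<open>simp add: loop_join_def\<close>)
    have "K = K1 \<union> (K \<inter> {1/2..1})"
      using KU(2) by (auto simp: K1_def)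
    then have "loop_join k h ` K \<subseteq> U \<longleftrightarrow> loop_join k h ` K1 \<subseteq> U \<and> loop_join k h ` (K \<inter> {1/2..1}) \<subseteq> U"
      by (metis image_Un le_sup_iff)
    moreover have "loop_join k h ` K1 \<subseteq> U \<longleftrightarrow> (\<forall>t\<in>K1. k (2 * t) \<in> U)"
      by (auto simp: K1_def loop_join_def)
    moreover have "loop_join k h ` (K \<inter> {1/2..1}) = h ` K2"
      unfolding K2_def image_image using eq by (intro image_cong) auto
    ultimately show ?thesis by simp
  qed
  then have "{h \<in> topspace (loop_space X a). loop_join k h ` K \<subseteq> U} =
      {h \<in> loops X a. (\<forall>t\<in>K1. k (2 * t) \<in> U) \<and> h ` K2 \<subseteq> U}"
    unfolding topspace_loop_space by (intro Collect_cong conj_cong refl)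
  also have "\<dots> = (if \<forall>t\<in>K1. k (2 * t) \<in> U then {h \<in> loops X a. h ` K2 \<subseteq> U} else {})"
    by simp
  finally have "{h \<in> topspace (loop_space X a). loop_join k h ` K \<subseteq> U} =
      (if \<forall>t\<in>K1. k (2 * t) \<in> U then {h \<in> loops X a. h ` K2 \<subseteq> U} else {})" .
  then show "openin (loop_space X a) {h \<in> topspace (loop_space X a). loop_join k h ` K \<subseteq> U}"
    using op by simp
qed (use assms loop_join_in_loops in auto)

lemma openin_pi1_top_singleton_transfer:
  assumes c: "c \<in> loops X a" and g: "g \<in> loops X a"
    and op: "openin (pi1_top X a) {loop_class X a c}"
  shows "openin (pi1_top X a) {loop_class X a g}"
proof -
  define k where "k = loop_join c (loop_rev g)"
  have k: "k \<in> loops X a"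
    by (simp add: k_def c g loop_join_in_loops loop_rev_in_loops)
  obtain G where G: "continuous_map (pi1_top X a) (pi1_top X a) G"
    "\<And>f. f \<in> loops X a \<Longrightarrow> G (loop_class X a f) = loop_class X a (loop_join k f)"
    using continuous_map_pi1_induced[OF continuous_map_loop_join[OF k] loop_join_cong[OF k]] by metis
  have "loop_homotopic X a (loop_join k h) c \<longleftrightarrow> loop_homotopic X a h g" if h: "h \<in> loops X a" for h
  proof
    assume "loop_homotopic X a h g"
    then show "loop_homotopic X a (loop_join k h) c"
      using loop_join_cong[OF k] loop_join_rev_cancel_right[OF c g] loop_homotopic_trans
      unfolding k_def by metis
  next
    assume 1: "loop_homotopic X a (loop_join k h) c"
    have 2: "loop_homotopic X a (loop_join k g) c"
      unfolding k_def by (rule loop_join_rev_cancel_right[OF c g])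
    have "loop_homotopic X a (loop_join (loop_rev k) (loop_join k h)) (loop_join (loop_rev k) (loop_join k g))"
      by (intro loop_join_cong loop_rev_in_loops k loop_homotopic_trans[OF 1 loop_homotopic_sym[OF 2]])
    then show "loop_homotopic X a h g"
      using loop_join_rev_cancel[OF k h] loop_join_rev_cancel[OF k g] loop_homotopic_trans loop_homotopic_sym
      by metis
  qed
  then have "loop_class X a (loop_join k h) = loop_class X a c \<longleftrightarrow> loop_class X a h = loop_class X a g"
    if "h \<in> loops X a" for h
    using that c g k by (simp add: loop_class_eq_iff loop_join_in_loops)
  then have "{x \<in> topspace (pi1_top X a). G x \<in> {loop_class X a c}} = {loop_class X a g}"
    unfolding topspace_pi1_top using G(2) g by (intro set_eqI) (simp only: mem_Collect_eq singleton_iff image_iff, metis)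
  then show ?thesis
    using openin_continuous_map_preimage[OF G(1) op] by simp
qed

lemma pi1_top_compact_Hausdorff_countable:
  assumes "compact_space (pi1_top X a)" "Hausdorff_space (pi1_top X a)" "countable (topspace (pi1_top X a))"
  shows "pi1_top X a = discrete_topology (topspace (pi1_top X a))"
proof (cases "topspace (pi1_top X a) = {}")
  case False
  let ?P = "pi1_top X a"
  have "?P derived_set_of topspace ?P \<noteq> topspace ?P"
  proof
    assume "?P derived_set_of topspace ?P = topspace ?P"
    then have "(UNIV::real set) \<lesssim> topspace ?P"
      using assms False by (intro lepoll_perfect_set) (auto simp: compact_imp_locally_compact_space)
    then show False
      using assms(3) uncountable_UNIV_real countable_lepoll by blast
  qed
  then obtain c T where c: "c \<in> topspace ?P" and T: "c \<in> T" "openin ?P T" "\<And>y. y \<in> topspace ?P \<Longrightarrow> y \<in> T \<Longrightarrow> y = c"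
    unfolding derived_set_of_def by blast
  have "T = {c}"
    using T openin_subset by fastforce
  with T have "openin ?P {c}"
    by simp
  have "openin ?P {d}" if d: "d \<in> topspace ?P" for d
  proof -
    obtain c' d' where "c' \<in> loops X a" "c = loop_class X a c'" "d' \<in> loops X a" "d = loop_class X a d'"
      using c d by (auto simp: topspace_pi1_top)
    then show ?thesis
      using openin_pi1_top_singleton_transfer \<open>openin ?P {c}\<close> by metis
  qed
  then show ?thesis
    by (metis discrete_topology_unique)
qed (metis null_topspace_iff_trivial)

section \<open>Collapsing one set\<close>

locale single_collapse =
  fixes X :: "'a topology" and Y :: "'b topology" and p :: "'a \<Rightarrow> 'b" and A :: "'a set"
  assumes quotient: "quotient_map X Y p"
    and subset: "A \<subseteq> topspace X"
    and eq_iff: "\<And>x y. x \<in> topspace X \<Longrightarrow> y \<in> topspace X \<Longrightarrow> p x = p y \<longleftrightarrow> x = y \<or> x \<in> A \<and> y \<in> A"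
    and path_connected_closure: "path_connectedin X (X closure_of A)"
    and open_or_closed: "openin X A \<or> closedin X A \<and> locally_path_connected_space X"
begin

lemma continuous: "continuous_map X Y p"
  by (simp add: quotient quotient_imp_continuous_map)

lemma image_in_topspace: "x \<in> topspace X \<Longrightarrow> p x \<in> topspace Y"
  using continuous by (auto simp: continuous_map_def)

lemma lift_point:
  assumes "y \<in> topspace Y"
  obtains x where "x \<in> topspace X" "p x = y"
  using assms quotient unfolding quotient_map_def by (metis imageE)

lemma closure_subset_topspace: "X closure_of A \<subseteq> topspace X"
  by (rule closure_of_subset_topspace)

lemma subset_closure: "A \<subseteq> X closure_of A"
  using subset by (rule closure_of_subset)

lemma in_closure_iff: "x \<in> topspace X \<Longrightarrow> p x \<in> p ` (X closure_of A) \<longleftrightarrow> x \<in> X closure_of A"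
  using closure_subset_topspace subset_closure eq_iff by blast

lemma openin_image:
  assumes "openin X N" "N \<inter> A = {} \<or> A \<subseteq> N"
  shows "openin Y (p ` N)"
proof -
  have "N \<subseteq> topspace X" using assms openin_subset by blast
  then have "{x \<in> topspace X. p x \<in> p ` N} = N"
    using assms(2) eq_iff by blast
  moreover have "p ` N \<subseteq> topspace Y"
    using \<open>N \<subseteq> topspace X\<close> image_in_topspace by auto
  moreover have "openin X {x \<in> topspace X. p x \<in> U} = openin Y U" if "U \<subseteq> topspace Y" for U
    using quotient that by (simp add: quotient_map_def)
  ultimately show ?thesis
    using assms(1) by metis
qed

lemma closedin_image_closure: "closedin Y (p ` (X closure_of A))"
proof -
  have "topspace Y - p ` (X closure_of A) = p ` (topspace X - X closure_of A)"
  proof (intro equalityI subsetI)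
    fix y assume y: "y \<in> topspace Y - p ` (X closure_of A)"
    then obtain x where "x \<in> topspace X" "p x = y"
      using lift_point by (metis DiffD1)
    then show "y \<in> p ` (topspace X - X closure_of A)"
      using y by auto
  next
    fix y assume "y \<in> p ` (topspace X - X closure_of A)"
    then obtain x where "x \<in> topspace X" "x \<notin> X closure_of A" "y = p x"
      by auto
    then show "y \<in> topspace Y - p ` (X closure_of A)"
      using in_closure_iff[of x] image_in_topspace by simp
  qed
  moreover have "openin Y (p ` (topspace X - X closure_of A))"
    using subset_closure by (intro openin_image) auto
  ultimately show ?thesis
    using image_in_topspace closure_subset_topspace by (auto simp: closedin_def)
qed

lemma lift_off_collapsed:
  assumes g: "continuous_map Z Y g" and off: "\<And>z. z \<in> topspace Z \<Longrightarrow> g z \<notin> p ` A"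
  obtains h where "continuous_map Z X h" "\<And>z. z \<in> topspace Z \<Longrightarrow> p (h z) = g z"
proof -
  let ?U = "topspace X - A" and ?V = "topspace Y - p ` A"
  have im: "p ` topspace X = topspace Y" using quotient by (simp add: quotient_map_def)
  have U: "{x \<in> topspace X. p x \<in> ?V} = ?U"
    using im eq_iff subset by blast
  have "openin X ?U \<or> closedin X ?U"
    using open_or_closed by auto
  moreover have "openin X ?U \<longleftrightarrow> openin Y ?V"
    using quotient[unfolded quotient_map_def, THEN conjunct2, rule_format, OF Diff_subset, of "p ` A"]
    unfolding U .
  moreover have "closedin X ?U \<longleftrightarrow> closedin Y ?V"
    using quotient[unfolded quotient_map_closedin, THEN conjunct2, rule_format, OF Diff_subset, of "p ` A"]
    unfolding U .
  ultimately have "openin Y ?V \<or> closedin Y ?V"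
    by simp
  then have "quotient_map (subtopology X ?U) (subtopology Y ?V) p"
    using quotient_map_restriction[OF quotient U] by blast
  moreover have "inj_on p (topspace (subtopology X ?U))"
    using eq_iff by (auto simp: inj_on_def)
  ultimately have "homeomorphic_map (subtopology X ?U) (subtopology Y ?V) p"
    by (simp add: homeomorphic_map_def)
  then obtain q where q: "homeomorphic_maps (subtopology X ?U) (subtopology Y ?V) p q"
    by (auto simp: homeomorphic_map_maps)
  have gV: "continuous_map Z (subtopology Y ?V) g"
    using g off continuous_map_funspace[OF g] by (auto simp: continuous_map_in_subtopology)
  then have "continuous_map Z (subtopology X ?U) (q \<circ> g)"
    using q by (auto simp: homeomorphic_maps_def intro: continuous_map_compose)
  moreover have "p ((q \<circ> g) z) = g z" if "z \<in> topspace Z" for z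
    using q gV that unfolding homeomorphic_maps_def continuous_map_def by auto
  ultimately show ?thesis
    using that by (meson continuous_map_in_subtopology)
qed

text \<open>\<open>p \<circ> \<alpha>\<close> need not stay in the prescribed sets \<open>W u\<close> itself, only up to a homotopy
  relative to the endpoints.\<close>

definition liftable :: "(real \<Rightarrow> 'b set) \<Rightarrow> real \<Rightarrow> real \<Rightarrow> 'a \<Rightarrow> 'a \<Rightarrow> bool" where
  "liftable W s t x y \<longleftrightarrow> (\<exists>\<alpha> (H :: real \<times> real \<Rightarrow> 'b).
     continuous_map (top_of_set {s..t}) X \<alpha> \<and> \<alpha> s = x \<and> \<alpha> t = y \<and>
     continuous_map (top_of_set ({0..1} \<times> {s..t})) Y H \<and>
     (\<forall>u\<in>{s..t}. H (1, u) = p (\<alpha> u) \<and> H (0, u) \<in> W u) \<and>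
     (\<forall>\<tau>\<in>{0..1}. H (\<tau>, s) = p x \<and> H (\<tau>, t) = p y))"

lemma liftableE:
  assumes "liftable W s t x y"
  obtains \<alpha> :: "real \<Rightarrow> 'a" and H :: "real \<times> real \<Rightarrow> 'b" where
    "continuous_map (top_of_set {s..t}) X \<alpha>" "\<alpha> s = x" "\<alpha> t = y"
    "continuous_map (top_of_set ({0..1} \<times> {s..t})) Y H"
    "\<And>u. u \<in> {s..t} \<Longrightarrow> H (1, u) = p (\<alpha> u)" "\<And>u. u \<in> {s..t} \<Longrightarrow> H (0, u) \<in> W u"
    "\<And>\<tau>. \<tau> \<in> {0..1} \<Longrightarrow> H (\<tau>, s) = p x" "\<And>\<tau>. \<tau> \<in> {0..1} \<Longrightarrow> H (\<tau>, t) = p y"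
  using assms unfolding liftable_def by blast

lemma liftable_rescale:
  assumes L: "liftable (\<lambda>_. U) s t x y" and st: "s \<le> t" "s' < t'"
    and W: "\<And>u. u \<in> {s'..t'} \<Longrightarrow> U \<subseteq> W u"
  shows "liftable W s' t' x y"
proof -
  obtain \<alpha> :: "real \<Rightarrow> 'a" and H :: "real \<times> real \<Rightarrow> 'b" where \<alpha>: "continuous_map (top_of_set {s..t}) X \<alpha>" "\<alpha> s = x" "\<alpha> t = y"
    and H: "continuous_map (top_of_set ({0..1} \<times> {s..t})) Y H"
     "\<And>u. u\<in>{s..t} \<Longrightarrow> H (1, u) = p (\<alpha> u)" "\<And>u. u\<in>{s..t} \<Longrightarrow> H (0, u) \<in> U"
     "\<And>\<tau>. \<tau>\<in>{0..1} \<Longrightarrow> H (\<tau>, s) = p x" "\<And>\<tau>. \<tau>\<in>{0..1} \<Longrightarrow> H (\<tau>, t) = p y"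
    by (rule liftableE[OF L]) blast
  define \<phi> where "\<phi> u = s + (u - s') / (t' - s') * (t - s)" for u
  have \<phi>: "\<phi> u \<in> {s..t}" if "u \<in> {s'..t'}" for u
  proof -
    have "0 \<le> (u - s') / (t' - s')" "(u - s') / (t' - s') \<le> 1"
      using that st by auto
    then have "(u - s') / (t' - s') * (t - s) \<le> 1 * (t - s)" "0 \<le> (u - s') / (t' - s') * (t - s)"
      using st by (intro mult_right_mono mult_nonneg_nonneg; simp)+
    then show ?thesis by (simp add: \<phi>_def)
  qed
  have ends: "\<phi> s' = s" "\<phi> t' = t" using st by (auto simp: \<phi>_def)
  have cont: "continuous_on S \<phi>" for S
    using st unfolding \<phi>_def by (intro continuous_intros) auto
  have "continuous_map (top_of_set {s'..t'}) X (\<lambda>u. \<alpha> (\<phi> u))"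
    using \<phi> cont by (intro continuous_map_top_of_set_compose[OF \<alpha>(1)])
  moreover have "continuous_map (top_of_set ({0..1} \<times> {s'..t'})) Y (\<lambda>z. H (fst z, \<phi> (snd z)))"
  proof (rule continuous_map_top_of_set_compose[OF H(1)])
    show "continuous_on ({0..1} \<times> {s'..t'}) (\<lambda>z. (fst z, \<phi> (snd z)))"
      by (intro continuous_intros continuous_on_compose2[OF cont[of UNIV]]) auto
  qed (use \<phi> in auto)
  moreover have "\<forall>u\<in>{s'..t'}. H (fst (1, u), \<phi> (snd (1, u))) = p (\<alpha> (\<phi> u)) \<and> H (fst (0, u), \<phi> (snd (0, u))) \<in> W u"
  proof
    fix u assume u: "u \<in> {s'..t'}"
    show "H (fst (1, u), \<phi> (snd (1, u))) = p (\<alpha> (\<phi> u)) \<and> H (fst (0, u), \<phi> (snd (0, u))) \<in> W u"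
      using H(2,3)[OF \<phi>[OF u]] W[OF u] by auto
  qed
  moreover have "\<forall>\<tau>\<in>{0..1}. H (fst (\<tau>, s'), \<phi> (snd (\<tau>, s'))) = p x \<and> H (fst (\<tau>, t'), \<phi> (snd (\<tau>, t'))) = p y"
    using H(4,5) ends by simp
  ultimately show ?thesis
    unfolding liftable_def using \<alpha>(2,3) ends
    by (intro exI[of _ "\<lambda>u. \<alpha> (\<phi> u)"] exI[of _ "\<lambda>z. H (fst z, \<phi> (snd z))"]) simp
qed

lemma liftable_concat:
  assumes L1: "liftable W r s x y" and L2: "liftable W s t y z" and rst: "r \<le> s" "s \<le> t"
  shows "liftable W r t x z"
proof -
  obtain \<alpha> :: "real \<Rightarrow> 'a" and H :: "real \<times> real \<Rightarrow> 'b" where \<alpha>: "continuous_map (top_of_set {r..s}) X \<alpha>" "\<alpha> r = x" "\<alpha> s = y"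
    and H: "continuous_map (top_of_set ({0..1} \<times> {r..s})) Y H"
     "\<And>u. u\<in>{r..s} \<Longrightarrow> H (1, u) = p (\<alpha> u)" "\<And>u. u\<in>{r..s} \<Longrightarrow> H (0, u) \<in> W u"
     "\<And>\<tau>. \<tau>\<in>{0..1} \<Longrightarrow> H (\<tau>, r) = p x" "\<And>\<tau>. \<tau>\<in>{0..1} \<Longrightarrow> H (\<tau>, s) = p y"
    by (rule liftableE[OF L1]) blast
  obtain \<beta> :: "real \<Rightarrow> 'a" and G :: "real \<times> real \<Rightarrow> 'b" where \<beta>: "continuous_map (top_of_set {s..t}) X \<beta>" "\<beta> s = y" "\<beta> t = z"
    and G: "continuous_map (top_of_set ({0..1} \<times> {s..t})) Y G"
     "\<And>u. u\<in>{s..t} \<Longrightarrow> G (1, u) = p (\<beta> u)" "\<And>u. u\<in>{s..t} \<Longrightarrow> G (0, u) \<in> W u"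
     "\<And>\<tau>. \<tau>\<in>{0..1} \<Longrightarrow> G (\<tau>, s) = p y" "\<And>\<tau>. \<tau>\<in>{0..1} \<Longrightarrow> G (\<tau>, t) = p z"
    by (rule liftableE[OF L2]) blast
  let ?\<alpha> = "\<lambda>u. if u \<le> s then \<alpha> u else \<beta> u"
  let ?H = "\<lambda>z :: real \<times> real. if snd z \<le> s then H z else G z"
  have sets: "{u \<in> {r..t}. u \<le> s} = {r..s}" "{u \<in> {r..t}. s \<le> u} = {s..t}"
    "{z \<in> {0..1::real} \<times> {r..t}. snd z \<le> s} = {0..1} \<times> {r..s}"
    "{z \<in> {0..1::real} \<times> {r..t}. s \<le> snd z} = {0..1} \<times> {s..t}"
    using rst by auto
  have "continuous_map (top_of_set {r..t}) X ?\<alpha>"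
    by (rule continuous_map_top_of_set_paste) (use \<alpha> \<beta> sets in auto)
  moreover have "continuous_map (top_of_set ({0..1} \<times> {r..t})) Y ?H"
    by (rule continuous_map_top_of_set_paste) (use H G sets in \<open>auto intro: continuous_intros\<close>)
  moreover have "\<forall>u\<in>{r..t}. ?H (1, u) = p (?\<alpha> u) \<and> ?H (0, u) \<in> W u"
    using H(2,3) G(2,3) by simp
  moreover have "\<forall>\<tau>\<in>{0..1}. ?H (\<tau>, r) = p x \<and> ?H (\<tau>, t) = p z"
    using H(4,5) G(4,5) rst \<beta> by (cases "s = t") auto
  moreover have "?\<alpha> r = x" "?\<alpha> t = z"
    using \<alpha> \<beta> rst by (cases "s = t"; simp)+
  ultimately show ?thesis
    unfolding liftable_def by (intro exI[of _ ?\<alpha>] exI[of _ ?H] conjI)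
qed

lemma liftable_trans:
  assumes "liftable (\<lambda>_. U) 0 1 x y" "liftable (\<lambda>_. U) 0 1 y z"
  shows "liftable (\<lambda>_. U) 0 1 x z"
  using liftable_concat[OF liftable_rescale[OF assms(1), of 0 "1/2"] liftable_rescale[OF assms(2), of "1/2" 1]]
  by simp

abbreviation preimage_space :: "'b set \<Rightarrow> 'a topology" where
  "preimage_space U \<equiv> subtopology X {x \<in> topspace X. p x \<in> U}"

lemma liftable_path_component:
  assumes "path_component_of (preimage_space U) x y"
  shows "liftable (\<lambda>_. U) 0 1 x y"
proof -
  obtain \<alpha> :: "real \<Rightarrow> 'a" where \<alpha>: "continuous_map (top_of_set {0..1}) (preimage_space U) \<alpha>" "\<alpha> 0 = x" "\<alpha> 1 = y"
    using assms unfolding path_component_of_def pathin_def by metis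
  then have X: "continuous_map (top_of_set {0..1}) X \<alpha>" and U: "\<And>u. u \<in> {0..1} \<Longrightarrow> p (\<alpha> u) \<in> U"
    by (auto simp: continuous_map_in_subtopology)
  have "continuous_map (top_of_set ({0..1::real} \<times> {0..1})) Y (\<lambda>z. (p \<circ> \<alpha>) (snd z))"
    by (rule continuous_map_top_of_set_compose[OF continuous_map_compose[OF X continuous]])
      (auto intro: continuous_intros)
  then show ?thesis
    unfolding liftable_def using X U \<alpha>
    by (intro exI[of _ \<alpha>] exI[of _ "\<lambda>z. (p \<circ> \<alpha>) (snd z)"]) simp
qed

text \<open>If \<open>A\<close> is open, its image is a point that is dense in the image of the closure, so a path in that
  image may be replaced by one that is constant except at the endpoints.\<close>

lemma liftable_within_closure:
  assumes U: "openin Y U" and xy: "x \<in> X closure_of A" "y \<in> X closure_of A" "p x \<in> U" "p y \<in> U"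
  shows "liftable (\<lambda>_. U) 0 1 x y"
proof -
  obtain \<alpha> :: "real \<Rightarrow> 'a" where \<alpha>: "continuous_map (top_of_set {0..1}) X \<alpha>" "\<alpha> \<in> {0..1} \<rightarrow> X closure_of A" "\<alpha> 0 = x" "\<alpha> 1 = y"
    using path_connected_closure xy unfolding path_connectedin pathin_def by metis
  obtain a where a: "a \<in> A"
    using xy(1) by (force simp: closure_of_def)
  have point: "p b = p a" if "b \<in> A" for b
    using a that eq_iff subset by blast
  show ?thesis
    using open_or_closed
  proof
    assume "closedin X A \<and> locally_path_connected_space X"
    then have "X closure_of A = A"
      by (simp add: closure_of_eq)
    then have "path_component_of (preimage_space U) x y"
      using \<alpha> xy point subset unfolding path_component_of_def pathin_def
      by (intro exI[of _ \<alpha>]) (auto simp: continuous_map_in_subtopology Pi_iff)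
    then show ?thesis
      by (rule liftable_path_component)
  next
    assume "openin X A"
    have dense: "p a \<in> V" if V: "openin Y V" and c: "c \<in> X closure_of A" "p c \<in> V" for V c
    proof -
      have "openin X {x \<in> topspace X. p x \<in> V}"
        by (rule openin_continuous_map_preimage[OF continuous V])
      moreover have "c \<in> {x \<in> topspace X. p x \<in> V}"
        using c closure_subset_topspace by blast
      ultimately obtain b where "b \<in> A" "b \<in> {x \<in> topspace X. p x \<in> V}"
        using c(1) unfolding in_closure_of by metis
      then have "b \<in> A" "p b \<in> V"
        by auto
      then show ?thesis using point by simp
    qed
    have closed_dense: "p c \<in> Z" if "closedin Y Z" "c \<in> X closure_of A" "p a \<in> Z" for Z c
      using dense[of "topspace Y - Z" c] that image_in_topspace closure_subset_topspace by blast
    define H where "H z = (if fst z = (1::real) then p (\<alpha> (snd z)) else if snd z = (0::real) then p x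
        else if snd z = 1 then p y else p a)" for z
    have Hclosure: "H z \<in> p ` (X closure_of A)" if "snd z \<in> {0..1}" for z
      using that \<alpha> xy a subset_closure by (auto simp: H_def)
    have "continuous_map (top_of_set ({0..1} \<times> {0..1})) Y H"
      unfolding continuous_map_closedin
    proof (intro conjI Pi_I allI impI)
      fix z :: "real \<times> real" assume "z \<in> topspace (top_of_set ({0..1} \<times> {0..1}))"
      then show "H z \<in> topspace Y"
        using Hclosure[of z] closedin_subset[OF closedin_image_closure] by auto
    next
      fix Z assume Z: "closedin Y Z"
      show "closedin (top_of_set ({0..1} \<times> {0..1})) {z \<in> topspace (top_of_set ({0..1} \<times> {0..1})). H z \<in> Z}"
      proof (cases "p a \<in> Z")
        case True
        have "H z \<in> Z" if "snd z \<in> {0..1}" for z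
          using Hclosure[OF that] closed_dense[OF Z _ True] by auto
        then have "{z \<in> topspace (top_of_set ({0..1::real} \<times> {0..1})). H z \<in> Z} = topspace (top_of_set ({0..1} \<times> {0..1}))"
          by auto
        then show ?thesis by (metis closedin_topspace)
      next
        case False
        define K where "K = {u \<in> {0..1}. p (\<alpha> u) \<in> Z}"
        have "closedin (top_of_set {0..1}) {u \<in> topspace (top_of_set {0..1}). (p \<circ> \<alpha>) u \<in> Z}"
          by (rule closedin_continuous_map_preimage[OF continuous_map_compose[OF \<alpha>(1) continuous] Z])
        then have "closed K"
          unfolding K_def by (simp add: closedin_closed_eq)
        have "{z \<in> topspace (top_of_set ({0..1} \<times> {0..1})). H z \<in> Z} =
           {1} \<times> K \<union> (if p x \<in> Z then {0..1} \<times> {0} else {}) \<union> (if p y \<in> Z then {0..1} \<times> {1} else {})"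
          (is "_ = ?S")
          using False \<alpha> by (auto simp: H_def K_def split: if_splits)
        moreover have "closed ?S"
          using \<open>closed K\<close> by (auto intro!: closed_Un closed_Times)
        ultimately have "closed {z \<in> topspace (top_of_set ({0..1} \<times> {0..1})). H z \<in> Z}"
          by (simp only:)
        then show ?thesis
          by (rule closed_subset[rotated]) auto
      qed
    qed
    moreover have "p a \<in> U"
      using dense[OF U xy(1,3)] .
    ultimately show ?thesis
      unfolding liftable_def using \<alpha> xy
      by (intro exI[of _ \<alpha>] exI[of _ H]) (auto simp: H_def)
  qed
qed

lemma path_component_of_image:
  fixes \<alpha> :: "real \<Rightarrow> 'a"
  assumes "continuous_map (top_of_set {s..t}) X \<alpha>" "\<And>u. u \<in> {s..t} \<Longrightarrow> p (\<alpha> u) \<in> U" "s \<le> t"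
  shows "path_component_of (preimage_space U) (\<alpha> s) (\<alpha> t)"
proof -
  have "continuous_map (top_of_set {s..t}) (preimage_space U) \<alpha>"
    using assms continuous_map_funspace[OF assms(1)] by (auto simp: continuous_map_in_subtopology)
  moreover have "path_connectedin (top_of_set {s..t}) {s..t}"
    by simp
  ultimately have "path_connectedin (preimage_space U) (\<alpha> ` {s..t})"
    by (rule path_connectedin_continuous_map_image)
  then show ?thesis
    using assms(3) by (auto simp: path_component_of)
qed

lemma reach_closure:
  fixes g :: "real \<Rightarrow> 'b"
  assumes g: "continuous_map (top_of_set {s..t}) Y g" and U: "openin Y U" "\<And>u. u \<in> {s..t} \<Longrightarrow> g u \<in> U"
    and st: "s \<le> t" "g t \<in> p ` (X closure_of A)" and x: "x \<in> topspace X" "p x = g s"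
  obtains x' where "x' \<in> X closure_of A" "path_component_of (preimage_space U) x x'"
proof (cases "x \<in> X closure_of A")
  case True
  then show ?thesis
  proof (rule that)
    show "path_component_of (preimage_space U) x x"
      using x U(2)[of s] st by (simp add: path_component_of_refl)
  qed
next
  case x_off: False
  show ?thesis
    using open_or_closed
  proof
    assume op: "openin X A"
    define D where "D = {u \<in> {s..t}. g u \<in> p ` (X closure_of A)}"
    have "closedin (top_of_set {s..t}) {u \<in> topspace (top_of_set {s..t}). g u \<in> p ` (X closure_of A)}"
      by (rule closedin_continuous_map_preimage[OF g closedin_image_closure])
    then have "closedin (top_of_set {s..t}) D"
      by (simp add: D_def)
    then have "compact D" "t \<in> D"
      using st by (auto simp: D_def intro: closedin_compact)
    then obtain r where r: "r \<in> D" "\<And>u. u \<in> D \<Longrightarrow> r \<le> u"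
      using compact_attains_inf[of D] by blast
    have "s \<noteq> r"
      using r(1) x x_off in_closure_iff[of x] by (auto simp: D_def)
    then have "s < r" "r \<le> t"
      using r(1) by (auto simp: D_def)
    have before: "g u \<notin> p ` (X closure_of A)" if "s \<le> u" "u < r" for u
      using r that \<open>r \<le> t\<close> by (force simp: D_def)
    have gr: "continuous_map (top_of_set {s..r}) Y g"
      using continuous_map_top_of_set_compose[OF g, of "{s..r}" "\<lambda>u. u"] \<open>r \<le> t\<close> by simp
    have "g r \<notin> p ` A"
    proof
      assume "g r \<in> p ` A"
      then have "{u \<in> topspace (top_of_set {s..r}). g u \<in> p ` A} = {r}"
        using before \<open>s < r\<close> subset_closure by force
      moreover have "openin Y (p ` A)"
        by (rule openin_image) (use op in auto)
      ultimately have "openin (top_of_set {s..r}) {r}"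
        using openin_continuous_map_preimage[OF gr] by metis
      moreover have "closedin (top_of_set {s..r}) {r}"
        using \<open>s < r\<close> by (simp add: closedin_closed_eq)
      ultimately have "{r} = {} \<or> {r} = {s..r}"
        using connected_Icc[of s r] unfolding connected_clopen by blast
      then show False
        using \<open>s < r\<close> by force
    qed
    then have "g u \<notin> p ` A" if "u \<in> topspace (top_of_set {s..r})" for u
      using that before[of u] subset_closure by (cases "u = r") auto
    then obtain \<alpha> :: "real \<Rightarrow> 'a" where \<alpha>: "continuous_map (top_of_set {s..r}) X \<alpha>" "\<And>u. u \<in> {s..r} \<Longrightarrow> p (\<alpha> u) = g u"
      using lift_off_collapsed[OF gr] by (metis topspace_euclidean_subtopology)
    have \<alpha>X: "\<alpha> u \<in> topspace X" if "u \<in> {s..r}" for u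
      using \<alpha>(1) that by (auto simp: continuous_map_def)
    have "p (\<alpha> s) = p x" "\<alpha> s \<in> topspace X"
      using \<alpha>(2) \<alpha>X x \<open>s < r\<close> by auto
    then have "\<alpha> s = x"
      using eq_iff[of "\<alpha> s" x] x x_off subset_closure by blast
    moreover have "\<alpha> r \<in> X closure_of A"
      using in_closure_iff[of "\<alpha> r"] \<alpha>X[of r] \<alpha>(2)[of r] \<open>s < r\<close> r(1) by (simp add: D_def)
    moreover have "path_component_of (preimage_space U) (\<alpha> s) (\<alpha> r)"
      using \<open>s < r\<close> \<open>r \<le> t\<close> U(2) \<alpha> by (intro path_component_of_image) auto
    ultimately show ?thesis
      using that by metis
  next
    assume cl: "closedin X A \<and> locally_path_connected_space X"
    then have clA: "X closure_of A = A"
      by (simp add: closure_of_eq)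
    let ?N = "{x \<in> topspace X. p x \<in> U}"
    have opN: "openin X ?N"
      by (rule openin_continuous_map_preimage[OF continuous U(1)])
    then have lpc: "locally_path_connected_space (preimage_space U)"
      using cl locally_path_connected_space_open_subset by blast
    define T where "T = Collect (path_component_of (preimage_space U) x)"
    have T_sub: "T \<subseteq> ?N"
      using path_component_of_subset_topspace[of "preimage_space U" x] by (auto simp: T_def)
    have "openin (preimage_space U) T"
      using lpc by (simp add: T_def openin_path_component_of_locally_path_connected_space)
    then have opT: "openin X T"
      using opN openin_trans_full by blast
    have "closedin (preimage_space U) T"
      using lpc by (simp add: T_def closedin_path_component_of_locally_path_connected_space)
    then have "openin (preimage_space U) (topspace (preimage_space U) - T)"
      by (simp add: closedin_def)
    moreover have "topspace (preimage_space U) - T = ?N - T"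
      by auto
    ultimately have opNT: "openin X (?N - T)"
      using opN openin_trans_full by metis
    have "T \<inter> A \<noteq> {}"
    proof
      assume disj: "T \<inter> A = {}"
      obtain b where b: "b \<in> A" "p b = g t" using st(2) clA by auto
      then have "A \<subseteq> ?N"
      proof (intro subsetI CollectI conjI)
        fix b' assume "b' \<in> A"
        then show "b' \<in> topspace X" "p b' \<in> U"
          using subset b eq_iff[of b' b] U(2)[of t] st(1) by (auto simp: subset_iff)
      qed
      then have 1: "openin Y (p ` T)" "openin Y (p ` (?N - T))"
        using disj opT opNT by (auto intro!: openin_image)
      have inter: "p ` T \<inter> p ` (?N - T) = {}"
      proof -
        have False if "v \<in> T" "w \<in> ?N - T" "p v = p w" for v w
          using that disj eq_iff[of v w] T_sub by auto
        then show ?thesis by blast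
      qed
      have "U \<subseteq> p ` ?N"
      proof
        fix y assume "y \<in> U"
        moreover from this obtain z where "z \<in> topspace X" "p z = y"
          using openin_subset[OF U(1)] lift_point by (metis subsetD)
        ultimately show "y \<in> p ` ?N" by auto
      qed
      then have cover: "g ` {s..t} \<subseteq> p ` T \<union> p ` (?N - T)"
        using U(2) by blast
      have "x \<in> T"
        using x U(2)[of s] st by (simp add: T_def path_component_of_refl)
      then have ne1: "p ` T \<inter> g ` {s..t} \<noteq> {}"
        using x st by force
      have ne2: "p ` (?N - T) \<inter> g ` {s..t} \<noteq> {}"
        using b \<open>A \<subseteq> ?N\<close> disj st by force
      have "connectedin Y (g ` {s..t})"
        by (rule connectedin_continuous_map_image[OF g]) simp
      then show False
        using 1 inter cover ne1 ne2 unfolding connectedin by blast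
    qed
    then show ?thesis
      using that clA by (auto simp: T_def)
  qed
qed

lemma liftable_local:
  fixes g :: "real \<Rightarrow> 'b"
  assumes g: "continuous_map (top_of_set {s..t}) Y g" and U: "openin Y U" "\<And>u. u \<in> {s..t} \<Longrightarrow> g u \<in> U"
    and r: "s \<le> r" "r \<le> t"
    and off: "g r \<notin> p ` (X closure_of A) \<Longrightarrow> (\<And>u. u \<in> {s..t} \<Longrightarrow> g u \<notin> p ` (X closure_of A))"
    and x: "x \<in> topspace X" "p x = g s" and y: "y \<in> topspace X" "p y = g t"
  shows "liftable (\<lambda>_. U) 0 1 x y"
proof (cases "g r \<in> p ` (X closure_of A)")
  case False
  then have out: "\<And>u. u \<in> {s..t} \<Longrightarrow> g u \<notin> p ` (X closure_of A)"
    using off by blast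
  then have "\<And>u. u \<in> topspace (top_of_set {s..t}) \<Longrightarrow> g u \<notin> p ` A"
    using subset_closure by auto
  then obtain \<alpha> :: "real \<Rightarrow> 'a" where \<alpha>: "continuous_map (top_of_set {s..t}) X \<alpha>" "\<And>u. u \<in> {s..t} \<Longrightarrow> p (\<alpha> u) = g u"
    using lift_off_collapsed[OF g] by (metis topspace_euclidean_subtopology)
  have "\<alpha> u = z" if "u \<in> {s..t}" "z \<in> topspace X" "p z = g u" for u z
  proof -
    have "\<alpha> u \<in> topspace X"
      using \<alpha>(1) that by (auto simp: continuous_map_def)
    moreover have "z \<notin> A"
      using out[OF that(1)] that(3) subset_closure by (metis imageI subsetD)
    ultimately show ?thesis
      using eq_iff[of "\<alpha> u" z] \<alpha>(2)[OF that(1)] that by auto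
  qed
  from this[of s x] this[of t y] have "\<alpha> s = x" "\<alpha> t = y"
    using x y r by simp_all
  moreover have "path_component_of (preimage_space U) (\<alpha> s) (\<alpha> t)"
    using r \<alpha> U(2) by (intro path_component_of_image) auto
  ultimately show ?thesis
    using liftable_path_component by metis
next
  case True
  have gs: "continuous_map (top_of_set {s..r}) Y g"
    using continuous_map_top_of_set_compose[OF g, of "{s..r}" "\<lambda>u. u"] r by simp
  obtain x' where x': "x' \<in> X closure_of A" "path_component_of (preimage_space U) x x'"
    by (rule reach_closure[OF gs U(1) _ r(1) True x]) (use U(2) r in auto)
  have gt: "continuous_map (top_of_set {-t..-r}) Y (\<lambda>u. g (- u))"
    by (rule continuous_map_top_of_set_compose[OF g]) (use r in \<open>auto intro: continuous_intros\<close>)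
  obtain y' where y': "y' \<in> X closure_of A" "path_component_of (preimage_space U) y y'"
    by (rule reach_closure[OF gt U(1), of y]) (use U(2) r y True in auto)
  have "p x' \<in> U" "p y' \<in> U"
    using x'(2) y'(2) by (auto dest!: path_component_in_topspace)
  then have "liftable (\<lambda>_. U) 0 1 x' y'"
    using liftable_within_closure U(1) x' y' by blast
  moreover have "liftable (\<lambda>_. U) 0 1 x x'" "liftable (\<lambda>_. U) 0 1 y' y"
    using x'(2) y'(2) by (auto intro: liftable_path_component path_component_of_sym)
  ultimately show ?thesis
    using liftable_trans by blast
qed

end

lemma loop_space_neighbourhood:
  assumes "openin (loop_space X a) N" "g \<in> N"
  obtains F :: "(real set \<times> 'a set) set" where "finite F"
    "\<And>K U. (K, U) \<in> F \<Longrightarrow> compact K \<and> K \<subseteq> {0..1} \<and> openin X U \<and> g ` K \<subseteq> U"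
    "\<And>h. h \<in> loops X a \<Longrightarrow> (\<And>K U. (K, U) \<in> F \<Longrightarrow> h ` K \<subseteq> U) \<Longrightarrow> h \<in> N"
proof -
  let ?S = "{{g \<in> loops X a. g ` K \<subseteq> U} | K U. compactin (top_of_set {0..1::real}) K \<and> openin X U}"
  define good where "good F N \<longleftrightarrow> finite F \<and>
      (\<forall>K U. (K, U) \<in> F \<longrightarrow> compact K \<and> K \<subseteq> {0..1} \<and> openin X U \<and> g ` K \<subseteq> U) \<and>
      (\<forall>h\<in>loops X a. (\<forall>K U. (K, U) \<in> F \<longrightarrow> h ` K \<subseteq> U) \<longrightarrow> h \<in> N)"
    for F :: "(real set \<times> 'a set) set" and N
  have "generate_topology_on ?S N"
    using assms(1) unfolding loop_space_def by (rule openin_topology_generated_by)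
  then have "g \<in> N \<Longrightarrow> \<exists>F. good F N"
  proof induction
    case (Int N1 N2)
    then obtain F1 F2 where F: "good F1 N1" "good F2 N2"
      by auto
    have "good (F1 \<union> F2) (N1 \<inter> N2)"
      unfolding good_def
    proof (intro conjI ballI impI allI)
      show "finite (F1 \<union> F2)"
        using F by (simp add: good_def)
      show "h \<in> N1 \<inter> N2" if "h \<in> loops X a" "\<forall>K U. (K, U) \<in> F1 \<union> F2 \<longrightarrow> h ` K \<subseteq> U" for h
        using F that by (simp add: good_def)
      fix K U assume "(K, U) \<in> F1 \<union> F2"
      then show "compact K" "K \<subseteq> {0..1}" "openin X U" "g ` K \<subseteq> U"
        using F unfolding good_def by (metis Un_iff)+
    qed
    then show ?case ..
  next
    case (UN \<N>)
    obtain N where N: "N \<in> \<N>" "g \<in> N"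
      using UN(3) by auto
    then obtain F where "good F N"
      using UN(2) by auto
    then have "good F (\<Union>\<N>)"
      using N(1) unfolding good_def by (metis UnionI)
    then show ?case ..
  next
    case (Basis N)
    then obtain K U where "N = {g \<in> loops X a. g ` K \<subseteq> U}" "compactin (top_of_set {0..1}) K" "openin X U"
      by auto
    then have "good {(K, U)} N"
      using Basis(2) by (simp add: good_def compactin_subtopology)
    then show ?case ..
  qed simp
  then obtain F where "good F N"
    using assms(2) by auto
  then show ?thesis
    unfolding good_def by (intro that[of F]) simp_all
qed

context single_collapse
begin

lemma liftable_loop:
  assumes g: "g \<in> loops Y (p a)" and a: "a \<in> topspace X"
    and F: "finite F" "\<And>K U. (K, U) \<in> F \<Longrightarrow> compact K \<and> openin Y U \<and> g ` K \<subseteq> U"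
  shows "liftable (\<lambda>u. \<Inter>{U. \<exists>K. (K, U) \<in> F \<and> u \<in> K}) 0 1 a a"
proof -
  let ?W = "\<lambda>u. \<Inter>{U. \<exists>K. (K, U) \<in> F \<and> u \<in> K}" and ?B = "p ` (X closure_of A)"
  define P where "P s t \<longleftrightarrow> (0 \<le> s \<longrightarrow> s < t \<longrightarrow> t \<le> 1 \<longrightarrow>
    (\<forall>x y. x \<in> topspace X \<longrightarrow> p x = g s \<longrightarrow> y \<in> topspace X \<longrightarrow> p y = g t \<longrightarrow> liftable ?W s t x y))" for s t
  have cont: "continuous_map (top_of_set {0..1}) Y g"
    using g by (rule loops_continuous)
  then have gY: "g u \<in> topspace Y" if "u \<in> {0..1}" for u
    using that by (auto simp: continuous_map_def)
  have "(0::real) \<le> 1"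
    by simp
  then have "P 0 1"
  proof (induction rule: Bolzano)
    case (trans r s t)
    show ?case
      unfolding P_def
    proof (intro impI allI)
      fix x z assume *: "0 \<le> r" "r < t" "t \<le> 1" "x \<in> topspace X" "p x = g r" "z \<in> topspace X" "p z = g t"
      consider "r = s" | "s = t" | "r < s" "s < t"
        using trans by linarith
      then show "liftable ?W r t x z"
      proof cases
        case 3
        obtain y where "y \<in> topspace X" "p y = g s"
          using lift_point[OF gY, of s] 3 * by auto
        then show ?thesis
          using trans * 3 unfolding P_def by (intro liftable_concat[of ?W r s x y t z]) auto
      qed (use trans * in \<open>auto simp: P_def\<close>)
    qed
  next
    case (local r)
    define G where "G = {f \<in> F. r \<in> fst f}"
    define U where "U = topspace Y \<inter> \<Inter>(snd ` G)"
    define V where "V = (if g r \<in> ?B then U else U - ?B)"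
    define K where "K = \<Union>(fst ` (F - G))"
    have "openin Y U"
      unfolding U_def
    proof (cases "G = {}")
      case False
      then show "openin Y (topspace Y \<inter> \<Inter>(snd ` G))"
        using F by (intro openin_Int openin_Inter) (auto simp: G_def)
    qed simp
    then have "openin Y V"
      using closedin_image_closure by (simp add: V_def openin_diff)
    have "g r \<in> V"
      using F(2) gY local by (auto simp: V_def U_def G_def)
    have "closed K"
      unfolding K_def using F by (intro closed_Union) (auto intro: compact_imp_closed)
    have "r \<notin> K"
      by (auto simp: K_def G_def)
    have "openin (top_of_set {0..1}) {u \<in> topspace (top_of_set {0..1}). g u \<in> V}"
      by (rule openin_continuous_map_preimage[OF cont \<open>openin Y V\<close>])
    then have "openin (top_of_set {0..1}) ({u \<in> {0..1}. g u \<in> V} - K)"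
      using \<open>closed K\<close> by (simp add: Diff_eq openin_Int_open open_Compl)
    moreover have "r \<in> {u \<in> {0..1}. g u \<in> V} - K"
      using local \<open>g r \<in> V\<close> \<open>r \<notin> K\<close> by simp
    ultimately obtain e where e: "e > 0" "\<And>u. u \<in> {0..1} \<Longrightarrow> dist u r < e \<Longrightarrow> g u \<in> V \<and> u \<notin> K"
      unfolding openin_euclidean_subtopology_iff by (metis (no_types, lifting) DiffE mem_Collect_eq)
    show ?case
    proof (intro exI conjI allI impI)
      fix s t assume st: "s \<le> r \<and> r \<le> t \<and> t - s < e"
      show "P s t"
        unfolding P_def
      proof (intro impI allI)
        fix x y assume *: "0 \<le> s" "s < t" "t \<le> 1" "x \<in> topspace X" "p x = g s" "y \<in> topspace X" "p y = g t"
        have near: "g u \<in> V" "u \<notin> K" if "u \<in> {s..t}" for u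
        proof -
          have "\<bar>u - r\<bar> < e"
            using that st by auto
          then show "g u \<in> V" "u \<notin> K"
            using e(2)[of u] that * by (auto simp: dist_real_def)
        qed
        have "continuous_map (top_of_set {s..t}) Y g"
          using continuous_map_top_of_set_compose[OF cont, of "{s..t}" "\<lambda>u. u"] * by simp
        then have L: "liftable (\<lambda>_. U) 0 1 x y"
        proof (rule liftable_local)
          show "g u \<in> U" if "u \<in> {s..t}" for u
            using near(1)[OF that] by (simp add: V_def split: if_splits)
          show "g u \<notin> ?B" if "g r \<notin> ?B" "u \<in> {s..t}" for u
            using near(1)[OF that(2)] that(1) by (simp add: V_def)
        qed (use \<open>openin Y U\<close> st * in simp_all)
        have sub: "U \<subseteq> ?W u" if "u \<in> {s..t}" for u
          using near(2)[OF that] by (force simp: U_def K_def G_def)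
        show "liftable ?W s t x y"
          by (rule liftable_rescale[where W = ?W, OF L zero_le_one *(2) sub])
      qed
    qed (use e in simp)
  qed
  then show ?thesis
    using a g by (simp add: P_def loops_def)
qed

lemma dense_lifts:
  assumes N: "openin (loop_space Y (p a)) N" "g \<in> N" and a: "a \<in> topspace X"
    and saturated: "\<And>f h. f \<in> N \<Longrightarrow> h \<in> loops Y (p a) \<Longrightarrow> loop_homotopic Y (p a) f h \<Longrightarrow> h \<in> N"
  obtains \<alpha> where "\<alpha> \<in> loops X a" "p \<circ> \<alpha> \<in> N"
proof -
  obtain F where F: "finite F" "\<And>K U. (K, U) \<in> F \<Longrightarrow> compact K \<and> K \<subseteq> {0..1} \<and> openin Y U \<and> g ` K \<subseteq> U"
    "\<And>h. h \<in> loops Y (p a) \<Longrightarrow> (\<And>K U. (K, U) \<in> F \<Longrightarrow> h ` K \<subseteq> U) \<Longrightarrow> h \<in> N"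
    by (rule loop_space_neighbourhood[OF N]) blast
  show ?thesis
  proof -
    have a_loop: "g \<in> loops Y (p a)"
      using N openin_subset by fastforce
    define W where "W u = \<Inter>{U. \<exists>K. (K, U) \<in> F \<and> u \<in> K}" for u
    have "liftable W 0 1 a a"
      unfolding W_def using F by (intro liftable_loop[OF a_loop a]) auto
    then obtain \<alpha> :: "real \<Rightarrow> 'a" and H :: "real \<times> real \<Rightarrow> 'b" where
      \<alpha>: "continuous_map (top_of_set {0..1}) X \<alpha>" "\<alpha> 0 = a" "\<alpha> 1 = a"
      and H: "continuous_map (top_of_set ({0..1} \<times> {0..1})) Y H"
        "\<And>u. u \<in> {0..1} \<Longrightarrow> H (1, u) = p (\<alpha> u)"
        "\<And>u. u \<in> {0..1} \<Longrightarrow> H (0, u) \<in> W u"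
        "\<And>\<tau>. \<tau> \<in> {0..1} \<Longrightarrow> H (\<tau>, 0) = p a" "\<And>\<tau>. \<tau> \<in> {0..1} \<Longrightarrow> H (\<tau>, 1) = p a"
      by (rule liftableE) (rule that)
    have \<alpha>_loop: "\<alpha> \<in> loops X a"
      using \<alpha> by (simp add: loops_def pathin_def)
    define h where "h u = H (0, u)" for u
    have "continuous_map (top_of_set {0..1}) Y h"
      unfolding h_def
      by (rule continuous_map_top_of_set_compose[OF H(1)]) (auto intro: continuous_intros)
    then have h_loop: "h \<in> loops Y (p a)"
      using H(4,5)[of 0] by (simp add: loops_def pathin_def h_def)
    have "h \<in> N"
    proof (rule F(3)[OF h_loop])
      fix K U assume KU: "(K, U) \<in> F"
      then have "K \<subseteq> {0..1}"
        using F(2) by blast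
      then show "h ` K \<subseteq> U"
        using H(3) KU by (force simp: h_def W_def)
    qed
    moreover have "loop_homotopic Y (p a) h (p \<circ> \<alpha>)"
      by (rule loop_homotopicI[OF H(1)]) (use H in \<open>simp_all add: h_def\<close>)
    ultimately have "p \<circ> \<alpha> \<in> N"
      using saturated compose_in_loops[OF continuous \<alpha>_loop] by blast
    then show ?thesis
      using that \<alpha>_loop by blast
  qed
qed

end

section \<open>Iterated collapsing\<close>

definition star_family :: "'a topology \<Rightarrow> ('i \<Rightarrow> 'a set) \<Rightarrow> 'i set \<Rightarrow> bool" where
  "star_family X B I \<longleftrightarrow>
     (\<forall>i\<in>I. openin X (B i) \<and> path_connectedin X (X closure_of B i)) \<or>
     (locally_path_connected_space X \<and>
      (\<forall>i\<in>I. (openin X (B i) \<or> closedin X (B i)) \<and> path_connectedin X (X closure_of B i)) \<and>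
      (\<forall>i\<in>I. \<forall>j\<in>I. i \<noteq> j \<longrightarrow> X closure_of B i \<inter> X closure_of B j = {}))"

context single_collapse
begin

lemma closedin_image:
  assumes "closedin X N" "N \<inter> A = {} \<or> A \<subseteq> N"
  shows "closedin Y (p ` N)"
proof -
  have N: "N \<subseteq> topspace X" using assms closedin_subset by blast
  have "{x \<in> topspace X. p x \<in> p ` N} = N"
  proof -
    have "x \<in> N" if "x \<in> topspace X" "p x = p z" "z \<in> N" for x z
      using that eq_iff[of x z] assms(2) N by auto
    then show ?thesis using N by auto
  qed
  moreover have "p ` N \<subseteq> topspace Y"
    using N image_in_topspace by auto
  moreover have "closedin X {x \<in> topspace X. p x \<in> V} = closedin Y V" if "V \<subseteq> topspace Y" for V
    using quotient that by (simp add: quotient_map_closedin)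
  ultimately show ?thesis
    using assms(1) by metis
qed

lemma closure_of_image_disjoint:
  assumes "B \<subseteq> topspace X" "X closure_of B \<inter> A = {}"
  shows "Y closure_of (p ` B) = p ` (X closure_of B)"
proof
  show "p ` (X closure_of B) \<subseteq> Y closure_of (p ` B)"
    by (rule continuous_map_image_closure_subset[OF continuous])
  have "p ` B \<subseteq> p ` (X closure_of B)"
    using assms(1) by (intro image_mono closure_of_subset)
  moreover have "closedin Y (p ` (X closure_of B))"
    using assms(2) by (intro closedin_image) auto
  ultimately show "Y closure_of (p ` B) \<subseteq> p ` (X closure_of B)"
    by (rule closure_of_minimal)
qed

lemma open_path_connected_image:
  assumes A: "openin X A" and B: "openin X B" "path_connectedin X (X closure_of B)"
  shows "openin Y (p ` B) \<and> path_connectedin Y (Y closure_of (p ` B))"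
proof (cases "A \<inter> B = {}")
  case True
  then have "X closure_of B \<inter> A = {}"
    using A openin_Int_closure_of_eq_empty by blast
  then show ?thesis
    using True B closure_of_image_disjoint[OF openin_subset] openin_image[of B]
      path_connectedin_continuous_map_image[OF continuous B(2)] by (simp add: Int_commute)
next
  case False
  then obtain c where c: "c \<in> A" "c \<in> B"
    by blast
  have "p b = p c" if "b \<in> A" for b
    using that c subset eq_iff[of b c] by auto
  then have "p ` A \<subseteq> p ` B"
    using c(2) by (metis image_subsetI imageI)
  have "p ` B = p ` (A \<union> B)"
    using \<open>p ` A \<subseteq> p ` B\<close> by auto
  moreover have "openin Y (p ` (A \<union> B))"
    using A B(1) by (intro openin_image) auto
  ultimately have "openin Y (p ` B)"
    by simp
  have BX: "B \<subseteq> topspace X"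
    using B(1) by (rule openin_subset)
  let ?C = "X closure_of A \<union> X closure_of B"
  have "Y closure_of (p ` B) = p ` ?C"
  proof
    have "closedin Y (p ` ?C)"
      using subset_closure by (intro closedin_image) auto
    moreover have "p ` B \<subseteq> p ` ?C"
      using closure_of_subset[OF BX] by blast
    ultimately show "Y closure_of (p ` B) \<subseteq> p ` ?C"
      by (intro closure_of_minimal)
    have "p ` (X closure_of A) \<subseteq> Y closure_of (p ` B)"
      using continuous_map_image_closure_subset[OF continuous, of A] closure_of_mono[OF \<open>p ` A \<subseteq> p ` B\<close>, of Y]
      by (rule order_trans)
    then show "p ` ?C \<subseteq> Y closure_of (p ` B)"
      using continuous_map_image_closure_subset[OF continuous, of B] by (simp add: image_Un)
  qed
  moreover have "path_connectedin X ?C"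
  proof (rule path_connectedin_Un[OF path_connected_closure B(2)])
    show "X closure_of A \<inter> X closure_of B \<noteq> {}"
      using c subset_closure closure_of_subset[OF BX] by blast
  qed
  ultimately show ?thesis
    using \<open>openin Y (p ` B)\<close> path_connectedin_continuous_map_image[OF continuous] by simp
qed

lemma star_family_image:
  assumes star: "star_family X B (insert k I)" and k: "k \<notin> I" "B k = A"
  shows "star_family Y (\<lambda>i. p ` B i) I"
  using star unfolding star_family_def[of X]
proof (elim disjE conjE)
  assume "\<forall>i\<in>insert k I. openin X (B i) \<and> path_connectedin X (X closure_of B i)"
  then show ?thesis
    unfolding star_family_def using open_path_connected_image k(2) by simp
next
  assume lpc: "locally_path_connected_space X"
    and B: "\<forall>i\<in>insert k I. (openin X (B i) \<or> closedin X (B i)) \<and> path_connectedin X (X closure_of B i)"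
    and disj: "\<forall>i\<in>insert k I. \<forall>j\<in>insert k I. i \<noteq> j \<longrightarrow> X closure_of B i \<inter> X closure_of B j = {}"
  have lpcY: "locally_path_connected_space Y"
    using locally_path_connected_space_quotient_map_image[OF quotient lpc] .
  have BX: "B i \<subseteq> topspace X" if "i \<in> I" for i
    using B that openin_subset[of X "B i"] closedin_subset[of X "B i"] by auto
  have disjA: "X closure_of B i \<inter> A = {}" if "i \<in> I" for i
  proof -
    have "X closure_of B i \<inter> X closure_of A = {}"
      using disj that k by auto
    then show ?thesis
      using subset_closure by auto
  qed
  then have disjA': "B i \<inter> A = {}" if "i \<in> I" for i
    using that closure_of_subset[OF BX] by fast
  have cl: "Y closure_of (p ` B i) = p ` (X closure_of B i)" if "i \<in> I" for i
    using that BX disjA by (intro closure_of_image_disjoint)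
  have "openin Y (p ` B i) \<or> closedin Y (p ` B i)" if "i \<in> I" for i
    using B that disjA'[OF that] openin_image[of "B i"] closedin_image[of "B i"] by auto
  moreover have "path_connectedin Y (Y closure_of (p ` B i))" if "i \<in> I" for i
    unfolding cl[OF that] using B that by (intro path_connectedin_continuous_map_image[OF continuous]) auto
  moreover have "Y closure_of (p ` B i) \<inter> Y closure_of (p ` B j) = {}" if "i \<in> I" "j \<in> I" "i \<noteq> j" for i j
  proof -
    have dij: "X closure_of B i \<inter> X closure_of B j = {}"
      using disj that by auto
    have "p v \<noteq> p w" if vw: "v \<in> X closure_of B i" "w \<in> X closure_of B j" for v w
    proof -
      have "v \<in> topspace X" "w \<in> topspace X"
        using vw closure_of_subset_topspace by (metis subsetD)+
      moreover have "v \<noteq> w" "v \<notin> A"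
        using vw dij disjA[OF \<open>i \<in> I\<close>] by auto
      ultimately show ?thesis
        using eq_iff[of v w] by simp
    qed
    then show ?thesis
      unfolding cl[OF that(1)] cl[OF that(2)] by auto
  qed
  ultimately show ?thesis
    unfolding star_family_def using lpcY by simp
qed

end

definition dense_loops :: "'a topology \<Rightarrow> 'a \<Rightarrow> 'b topology \<Rightarrow> ('a \<Rightarrow> 'b) \<Rightarrow> bool" where
  "dense_loops X a Y p \<longleftrightarrow>
     (\<forall>N. openin (loop_space Y (p a)) N \<longrightarrow> N \<noteq> {} \<longrightarrow>
       (\<forall>f\<in>N. \<forall>h\<in>loops Y (p a). loop_homotopic Y (p a) f h \<longrightarrow> h \<in> N) \<longrightarrow>
       (\<exists>\<alpha>\<in>loops X a. p \<circ> \<alpha> \<in> N))"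

lemma dense_loopsD:
  assumes "dense_loops X a Y p" "openin (loop_space Y (p a)) N" "N \<noteq> {}"
    "\<forall>f\<in>N. \<forall>h\<in>loops Y (p a). loop_homotopic Y (p a) f h \<longrightarrow> h \<in> N"
  shows "\<exists>\<alpha>\<in>loops X a. p \<circ> \<alpha> \<in> N"
  using assms by (simp add: dense_loops_def)

lemma (in single_collapse) dense_loops: "a \<in> topspace X \<Longrightarrow> dense_loops X a Y p"
  unfolding dense_loops_def
proof (intro allI impI)
  fix N assume a: "a \<in> topspace X" and N: "openin (loop_space Y (p a)) N" "N \<noteq> {}"
    and sat: "\<forall>f\<in>N. \<forall>h\<in>loops Y (p a). loop_homotopic Y (p a) f h \<longrightarrow> h \<in> N"
  then obtain g where "g \<in> N" by blast
  from dense_lifts[OF N(1) this a] sat show "\<exists>\<alpha>\<in>loops X a. p \<circ> \<alpha> \<in> N"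
    by metis
qed

lemma dense_loops_compose:
  assumes "continuous_map Y Z q" "dense_loops X a Y p" "dense_loops Y (p a) Z q"
  shows "dense_loops X a Z (q \<circ> p)"
  unfolding dense_loops_def
proof (intro allI impI)
  fix N assume N': "openin (loop_space Z ((q \<circ> p) a)) N" and ne: "N \<noteq> {}"
    and sat': "\<forall>f\<in>N. \<forall>h\<in>loops Z ((q \<circ> p) a). loop_homotopic Z ((q \<circ> p) a) f h \<longrightarrow> h \<in> N"
  note N = N'[unfolded o_apply] ne and sat = sat'[unfolded o_apply]
  let ?M = "{f \<in> topspace (loop_space Y (p a)). q \<circ> f \<in> N}"
  have "openin (loop_space Y (p a)) ?M"
    by (rule openin_continuous_map_preimage[OF continuous_map_loop_space_compose[OF assms(1)] N(1)])
  moreover have "?M \<noteq> {}"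
    using dense_loopsD[OF assms(3) N sat] by auto
  moreover have "\<forall>f\<in>?M. \<forall>h\<in>loops Y (p a). loop_homotopic Y (p a) f h \<longrightarrow> h \<in> ?M"
  proof (intro ballI impI)
    fix f h assume "f \<in> ?M" "h \<in> loops Y (p a)" "loop_homotopic Y (p a) f h"
    then show "h \<in> ?M"
      using sat compose_in_loops[OF assms(1), of h] loop_homotopic_compose[OF assms(1), of "p a" f h] by auto
  qed
  ultimately have "\<exists>\<alpha>\<in>loops X a. p \<circ> \<alpha> \<in> ?M"
    by (rule dense_loopsD[OF assms(2)])
  then obtain \<alpha> where "\<alpha> \<in> loops X a" "q \<circ> (p \<circ> \<alpha>) \<in> N"
    by auto
  then show "\<exists>\<alpha>\<in>loops X a. q \<circ> p \<circ> \<alpha> \<in> N"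
    by (auto simp: comp_assoc)
qed

lemma dense_loops_cong:
  assumes p: "continuous_map X Y p" and eq: "\<And>x. x \<in> topspace X \<Longrightarrow> p x = p' x" and a: "a \<in> topspace X"
    and dense: "dense_loops X a Y p"
  shows "dense_loops X a Y p'"
  unfolding dense_loops_def
proof (intro allI impI)
  fix N assume N: "openin (loop_space Y (p' a)) N" "N \<noteq> {}"
    and sat: "\<forall>f\<in>N. \<forall>h\<in>loops Y (p' a). loop_homotopic Y (p' a) f h \<longrightarrow> h \<in> N"
  have "\<exists>\<alpha>\<in>loops X a. p \<circ> \<alpha> \<in> N"
    by (rule dense_loopsD[OF dense]) (use N sat eq[OF a] in auto)
  then obtain \<alpha> where \<alpha>: "\<alpha> \<in> loops X a" "p \<circ> \<alpha> \<in> N"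
    by auto
  have p': "continuous_map X Y p'"
    using p eq by (rule continuous_map_eq)
  have ends: "\<alpha> 0 = a" "\<alpha> 1 = a" "continuous_map (top_of_set {0..1}) X \<alpha>"
    using \<alpha> by (auto simp: loops_def pathin_def)
  have "loop_homotopic Y (p' a) (p \<circ> \<alpha>) (p' \<circ> \<alpha>)"
    unfolding loop_homotopic_def
  proof (rule homotopic_with_equal)
    show "continuous_map (top_of_set {0..1}) Y (p \<circ> \<alpha>)"
      by (rule continuous_map_compose[OF ends(3) p])
    fix t assume "t \<in> topspace (top_of_set {0..1::real})"
    then have "\<alpha> t \<in> topspace X"
      using continuous_map_funspace[OF ends(3)] by auto
    then show "(p \<circ> \<alpha>) t = (p' \<circ> \<alpha>) t"
      using eq by simp
  qed (use ends eq[OF a] in simp_all)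
  then have "p' \<circ> \<alpha> \<in> N"
    using sat \<alpha>(2) compose_in_loops[OF p' \<alpha>(1)] by metis
  then show "\<exists>\<alpha>\<in>loops X a. p' \<circ> \<alpha> \<in> N"
    using \<alpha>(1) by metis
qed

lemma sym_collapse_rel:
  assumes "(x, y) \<in> collapse_rel X A n"
  shows "(y, x) \<in> collapse_rel X A n"
proof -
  have "sym (collapse_rel X A n)"
    unfolding collapse_rel_def by (rule sym_rtrancl) (auto simp: sym_def)
  then show ?thesis
    using assms by (rule symD)
qed

lemma trans_collapse_rel:
  "(x, y) \<in> collapse_rel X A n \<Longrightarrow> (y, z) \<in> collapse_rel X A n \<Longrightarrow> (x, z) \<in> collapse_rel X A n"
  unfolding collapse_rel_def by (rule rtrancl_trans)

lemma collapse_map_eq_iff: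
  assumes "x \<in> topspace X" "y \<in> topspace X"
  shows "collapse_map X A n x = collapse_map X A n y \<longleftrightarrow> (x, y) \<in> collapse_rel X A n"
proof
  have "(y, y) \<in> collapse_rel X A n"
    by (simp add: collapse_rel_def)
  then have "y \<in> collapse_map X A n y"
    using assms by (simp add: collapse_map_def)
  then show "(x, y) \<in> collapse_rel X A n" if "collapse_map X A n x = collapse_map X A n y"
    using that by (auto simp: collapse_map_def)
  show "collapse_map X A n x = collapse_map X A n y" if "(x, y) \<in> collapse_rel X A n"
    using that sym_collapse_rel[OF that] unfolding collapse_map_def
    by (auto intro: trans_collapse_rel)
qed

lemma collapse_rel_0: "(x, y) \<in> collapse_rel X A 0 \<longleftrightarrow> x = y"
proof -
  have "(Id_on (topspace X))\<^sup>* = Id"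
    using rtrancl_subset[of "{}" "Id_on (topspace X)"] by auto
  then show ?thesis
    by (simp add: collapse_rel_def)
qed

lemma collapse_rel_Suc:
  "(x, y) \<in> collapse_rel X A (Suc n) \<longleftrightarrow> (x, y) \<in> collapse_rel X A n \<or>
     (\<exists>b\<in>A n. \<exists>c\<in>A n. (x, b) \<in> collapse_rel X A n \<and> (c, y) \<in> collapse_rel X A n)"
  (is "_ \<longleftrightarrow> ?R x y")
proof
  assume "(x, y) \<in> collapse_rel X A (Suc n)"
  then show "?R x y"
    unfolding collapse_rel_def[of X A "Suc n"]
  proof (induction rule: rtrancl_induct)
    case base
    then show ?case by (simp add: collapse_rel_def)
  next
    case (step y z)
    then consider "(y, z) \<in> collapse_rel X A n" | "y \<in> A n" "z \<in> A n"
      unfolding collapse_rel_def by (auto simp: less_Suc_eq)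
    then show ?case
    proof cases
      case 1
      then show ?thesis using step.IH trans_collapse_rel by metis
    next
      case 2
      have "(z, z) \<in> collapse_rel X A n" "(y, y) \<in> collapse_rel X A n"
        by (simp_all add: collapse_rel_def)
      then show ?thesis using step.IH 2 by metis
    qed
  qed
next
  have mono: "collapse_rel X A n \<subseteq> collapse_rel X A (Suc n)"
    unfolding collapse_rel_def by (intro rtrancl_mono) (auto simp: less_Suc_eq)
  have "(b, c) \<in> collapse_rel X A (Suc n)" if "b \<in> A n" "c \<in> A n" for b c
    unfolding collapse_rel_def using that by (intro r_into_rtrancl) auto
  then show "?R x y \<Longrightarrow> (x, y) \<in> collapse_rel X A (Suc n)"
    using mono trans_collapse_rel by (metis subsetD)
qed

lemma topspace_collapse_space: "topspace (collapse_space X A n) = collapse_map X A n ` topspace X"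
  by (simp add: collapse_space_def)

lemma quotient_map_collapse: "quotient_map X (collapse_space X A n) (collapse_map X A n)"
  unfolding collapse_space_def by (rule quotient_map_quotient_topology)

lemma collapse_step:
  assumes An: "A n \<subseteq> topspace X"
  obtains q where "\<And>x. x \<in> topspace X \<Longrightarrow> q (collapse_map X A n x) = collapse_map X A (Suc n) x"
    "quotient_map (collapse_space X A n) (collapse_space X A (Suc n)) q"
    "\<And>u v. u \<in> topspace (collapse_space X A n) \<Longrightarrow> v \<in> topspace (collapse_space X A n) \<Longrightarrow>
       q u = q v \<longleftrightarrow> u = v \<or> u \<in> collapse_map X A n ` A n \<and> v \<in> collapse_map X A n ` A n"
proof -
  let ?p = "collapse_map X A n" and ?p' = "collapse_map X A (Suc n)"
  note eq = collapse_map_eq_iff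
  have cont: "continuous_map X (collapse_space X A (Suc n)) ?p'"
    by (rule quotient_imp_continuous_map[OF quotient_map_collapse])
  have fac: "\<And>x y. x \<in> topspace X \<Longrightarrow> y \<in> topspace X \<Longrightarrow> ?p x = ?p y \<Longrightarrow> ?p' x = ?p' y"
    by (simp add: eq collapse_rel_Suc)
  obtain q where q: "continuous_map (collapse_space X A n) (collapse_space X A (Suc n)) q"
    "\<And>x. x \<in> topspace X \<Longrightarrow> q (?p x) = ?p' x"
    by (rule quotient_map_lift_exists[OF quotient_map_collapse[of X A n] cont]) (erule (2) fac, rule that)
  have "quotient_map X (collapse_space X A (Suc n)) (q \<circ> ?p)"
    by (rule quotient_map_eq[OF quotient_map_collapse]) (simp add: q)
  then have "quotient_map (collapse_space X A n) (collapse_space X A (Suc n)) q"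
    by (rule quotient_map_from_composition[OF quotient_imp_continuous_map[OF quotient_map_collapse] q(1)])
  moreover have "q u = q v \<longleftrightarrow> u = v \<or> u \<in> ?p ` A n \<and> v \<in> ?p ` A n"
    if uv: "u \<in> topspace (collapse_space X A n)" "v \<in> topspace (collapse_space X A n)" for u v
  proof -
    obtain x y where xy: "x \<in> topspace X" "u = ?p x" "y \<in> topspace X" "v = ?p y"
      using uv by (auto simp: topspace_collapse_space)
    have "u \<in> ?p ` A n \<longleftrightarrow> (\<exists>b\<in>A n. (x, b) \<in> collapse_rel X A n)"
      using xy An eq[of x X _ A n] by (auto simp: image_iff subset_iff)
    moreover have "v \<in> ?p ` A n \<longleftrightarrow> (\<exists>c\<in>A n. (c, y) \<in> collapse_rel X A n)"
    proof -
      have "?p y = ?p c \<longleftrightarrow> (c, y) \<in> collapse_rel X A n" if "c \<in> A n" for c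
        using that xy An eq[of c X y A n] by (auto simp: subset_iff)
      then show ?thesis
        using xy by (auto simp: image_iff)
    qed
    ultimately show ?thesis
      using xy q(2) eq[of x X y] by (auto simp: collapse_rel_Suc)
  qed
  ultimately show ?thesis
    using that q(2) by metis
qed

lemma collapse_dense_loops:
  assumes sub: "\<forall>i<n. A i \<subseteq> topspace X" and star: "star_family X A {..<n}" and a: "a \<in> topspace X"
    and m: "m \<le> n"
  shows "dense_loops X a (collapse_space X A m) (collapse_map X A m) \<and>
    star_family (collapse_space X A m) (\<lambda>i. collapse_map X A m ` A i) {m..<n}"
  using m
proof (induction m)
  case 0
  interpret single_collapse X "collapse_space X A 0" "collapse_map X A 0" "{}"
    by unfold_locales (simp_all add: quotient_map_collapse collapse_map_eq_iff collapse_rel_0)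
  have "star_family X (A(n := {})) (insert n {..<n})"
    using star by (auto simp: star_family_def)
  then have "star_family (collapse_space X A 0) (\<lambda>i. collapse_map X A 0 ` (A(n := {})) i) {..<n}"
    by (rule star_family_image) simp_all
  then have "star_family (collapse_space X A 0) (\<lambda>i. collapse_map X A 0 ` A i) {..<n}"
    by (simp add: star_family_def)
  then show ?case
    using dense_loops[OF a] by (simp add: atLeast0LessThan)
next
  case (Suc m)
  let ?Y = "collapse_space X A m" and ?p = "collapse_map X A m"
  have IH: "dense_loops X a ?Y ?p" "star_family ?Y (\<lambda>i. ?p ` A i) {m..<n}"
    using Suc by simp_all
  have mn: "m < n" "A m \<subseteq> topspace X"
    using Suc(2) sub by auto
  obtain q where q: "\<And>x. x \<in> topspace X \<Longrightarrow> q (?p x) = collapse_map X A (Suc m) x"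
    "quotient_map ?Y (collapse_space X A (Suc m)) q"
    "\<And>u v. u \<in> topspace ?Y \<Longrightarrow> v \<in> topspace ?Y \<Longrightarrow> q u = q v \<longleftrightarrow> u = v \<or> u \<in> ?p ` A m \<and> v \<in> ?p ` A m"
    by (rule collapse_step[where A = A and n = m, OF mn(2)]) (rule that)
  interpret single_collapse ?Y "collapse_space X A (Suc m)" q "?p ` A m"
  proof
    show "?p ` A m \<subseteq> topspace ?Y"
      using mn by (auto simp: topspace_collapse_space)
    show "path_connectedin ?Y (?Y closure_of ?p ` A m)"
      "openin ?Y (?p ` A m) \<or> closedin ?Y (?p ` A m) \<and> locally_path_connected_space ?Y"
      using IH(2) mn unfolding star_family_def by auto
  qed (use q in auto)
  have "{m..<n} = insert m {Suc m..<n}"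
    using mn by auto
  then have "star_family ?Y (\<lambda>i. ?p ` A i) (insert m {Suc m..<n})"
    using IH(2) by simp
  then have "star_family (collapse_space X A (Suc m)) (\<lambda>i. q ` ?p ` A i) {Suc m..<n}"
    by (rule star_family_image) simp_all
  moreover have "q ` ?p ` A i = collapse_map X A (Suc m) ` A i" if "i \<in> {Suc m..<n}" for i
    unfolding image_image using q(1) sub that by (intro image_cong) (auto simp: subset_iff)
  ultimately have "star_family (collapse_space X A (Suc m)) (\<lambda>i. collapse_map X A (Suc m) ` A i) {Suc m..<n}"
    unfolding star_family_def by simp
  moreover have "dense_loops X a (collapse_space X A (Suc m)) (q \<circ> ?p)"
    using a by (intro dense_loops_compose[OF continuous IH(1)] dense_loops) (simp add: topspace_collapse_space)
  then have "dense_loops X a (collapse_space X A (Suc m)) (collapse_map X A (Suc m))"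
    by (rule dense_loops_cong[rotated 3])
      (use q(1) a continuous_map_compose[OF quotient_imp_continuous_map[OF quotient_map_collapse] continuous] in auto)
  ultimately show ?case by blast
qed

lemma compact_space_pi1_top_dense_loops:
  assumes p: "continuous_map X Y p" and dense: "dense_loops X a Y p"
    and compact: "compact_space (pi1_top X a)" and Hausdorff: "Hausdorff_space (pi1_top Y (p a))"
  shows "compact_space (pi1_top Y (p a))"
proof -
  let ?c = "loop_class Y (p a)"
  let ?S = "(\<lambda>\<alpha>. ?c (p \<circ> \<alpha>)) ` loops X a" and ?T = "topspace (pi1_top Y (p a))"
  obtain G where G: "continuous_map (pi1_top X a) (pi1_top Y (p a)) G"
    "\<And>\<alpha>. \<alpha> \<in> loops X a \<Longrightarrow> G (loop_class X a \<alpha>) = ?c (p \<circ> \<alpha>)"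
    by (rule continuous_map_pi1_induced[OF continuous_map_loop_space_compose[OF p, of a]])
      (erule loop_homotopic_compose[OF p], rule that)
  have "compactin (pi1_top Y (p a)) (G ` topspace (pi1_top X a))"
    using compact G(1) by (intro image_compactin) (auto simp: compact_space_def)
  moreover have "G ` topspace (pi1_top X a) = ?S"
    unfolding topspace_pi1_top image_image using G(2) by (intro image_cong) auto
  ultimately have S: "compactin (pi1_top Y (p a)) ?S"
    by simp
  then have "closedin (pi1_top Y (p a)) ?S"
    using Hausdorff compactin_imp_closedin by metis
  then have op: "openin (pi1_top Y (p a)) (?T - ?S)"
    by (simp add: closedin_def)
  let ?N = "{f \<in> topspace (loop_space Y (p a)). ?c f \<in> ?T - ?S}"
  have "?T \<subseteq> ?S"
  proof (rule ccontr)
    assume "\<not> ?T \<subseteq> ?S"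
    then have "?N \<noteq> {}"
      unfolding topspace_pi1_top topspace_loop_space by auto
    moreover have "openin (loop_space Y (p a)) ?N"
      by (rule openin_continuous_map_preimage[OF quotient_imp_continuous_map[OF quotient_map_loop_class] op])
    moreover have "\<forall>f\<in>?N. \<forall>h\<in>loops Y (p a). loop_homotopic Y (p a) f h \<longrightarrow> h \<in> ?N"
    proof (intro ballI impI)
      fix f h assume f: "f \<in> ?N" and h: "h \<in> loops Y (p a)" "loop_homotopic Y (p a) f h"
      then have "?c h = ?c f"
        using loop_class_eq_iff[of f Y "p a" h] by simp
      then show "h \<in> ?N"
        using f h by simp
    qed
    ultimately have "\<exists>\<alpha>\<in>loops X a. p \<circ> \<alpha> \<in> ?N"
      by (intro dense_loopsD[OF dense])
    then show False
      by auto
  qed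
  then show ?thesis
    using S compactin_subset_topspace[OF S] by (simp add: compact_space_def subset_antisym)
qed

theorem theorem4p5:
  fixes X :: "'a topology" and A :: "nat \<Rightarrow> 'a set" and n :: nat and a :: 'a
  assumes "\<forall>i<n. A i \<subseteq> topspace X"
    and "condition_star X A n"
    and "a \<in> (\<Union>i<n. A i)"
    and "compact_space (pi1_top X a)"
    and "Hausdorff_space (pi1_top (collapse_space X A n) (collapse_map X A n a))"
  shows "pi1_top (collapse_space X A n) (collapse_map X A n a)
           = discrete_topology (topspace (pi1_top (collapse_space X A n) (collapse_map X A n a)))
         \<or> uncountable (topspace (pi1_top (collapse_space X A n) (collapse_map X A n a)))"
proof -
  let ?P = "pi1_top (collapse_space X A n) (collapse_map X A n a)"
  have a: "a \<in> topspace X"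
    using assms(1,3) by auto
  have star: "star_family X A {..<n}"
    using assms(2) unfolding condition_star_def star_family_def by auto
  have p: "continuous_map X (collapse_space X A n) (collapse_map X A n)"
    by (rule quotient_imp_continuous_map[OF quotient_map_collapse])
  have "dense_loops X a (collapse_space X A n) (collapse_map X A n)"
    using collapse_dense_loops[OF assms(1) star a order_refl] ..
  then have "compact_space ?P"
    by (rule compact_space_pi1_top_dense_loops[OF p _ assms(4,5)])
  then have "?P = discrete_topology (topspace ?P)" if "countable (topspace ?P)"
    using assms(5) that by (rule pi1_top_compact_Hausdorff_countable)
  then show ?thesis
    by fast
qed

end
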